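(* Let $\epsilon>0$. For $n\in\mathbb{N}$ and real $X\ge 1$, let $S(n,X)$ denote the number of $2\times 2$ matrices $A$ with integer entries such that $\det(A)=n$ and every entry of $A$ has absolute value at most $X$. Then \[ S(n,X)=\frac{96\,\sigma_{-1}(n)}{\pi^2}X^2+O_\epsilon\left(\sigma_0(n)\,X\log X+nX^\epsilon\right), \] where the implied constant depends only on $\epsilon$ (and is uniform in $n$ and $X$).
   Context: For $s\in\mathbb{R}$ and $n\in\mathbb{N}$, $\sigma_s(n)=\sum_{d\mid n} d^s$ denotes the sum of the $s$-th powers of the positive divisors of $n$; in particular $\sigma_0(n)$ is the number of positive divisors of $n$ and $\sigma_{-1}(n)=\sum_{d\mid n}1/d$. *)

theory Defs
  imports "HOL-Analysis.Analysis"
begin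

text \<open>The real exponent is handled by \<^const>\<open>powr\<close>, so the value is the usual
  one for \<open>n > 0\<close>; for \<open>n = 0\<close> the index set is infinite and the sum is \<open>0\<close> by convention.\<close>

definition divisor_sigma :: "real \<Rightarrow> nat \<Rightarrow> real" where
  "divisor_sigma s n = (\<Sum>d | d dvd n. real d powr s)"

definition bounded_det_matrices :: "nat \<Rightarrow> real \<Rightarrow> (int^2^2) set" where
  "bounded_det_matrices n X =
     {A. det A = int n \<and> (\<forall>i j. \<bar>real_of_int (A $ i $ j)\<bar> \<le> X)}"

text \<open>Finiteness guarantees that \<^const>\<open>card\<close> below is a genuine count.\<close>

lemma finite_bounded_det_matrices: "finite (bounded_det_matrices n X)"
proof -
  let ?f = "\<lambda>(a, b, c, d). (vector [vector [a, b], vector [c, d]] :: int^2^2)"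
  let ?I = "{-\<lfloor>X\<rfloor>..\<lfloor>X\<rfloor>}"
  have "bounded_det_matrices n X \<subseteq> ?f ` (?I \<times> ?I \<times> ?I \<times> ?I)"
  proof
    fix A assume "A \<in> bounded_det_matrices n X"
    then have le: "\<bar>real_of_int (A $ i $ j)\<bar> \<le> X" for i j
      by (simp add: bounded_det_matrices_def)
    have mem: "A $ i $ j \<in> ?I" for i j
      using le[of i j] by (auto simp: abs_le_iff) linarith+
    have "A = ?f (A $ 1 $ 1, A $ 1 $ 2, A $ 2 $ 1, A $ 2 $ 2)"
      by (simp add: vec_eq_iff forall_2)
    with mem show "A \<in> ?f ` (?I \<times> ?I \<times> ?I \<times> ?I)"
      by blast
  qed
  then show ?thesis
    by (rule finite_subset) simp
qed

definition num_det_matrices :: "nat \<Rightarrow> real \<Rightarrow> nat" where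
  "num_det_matrices n X = card (bounded_det_matrices n X)"

end

theory Submission
  imports Defs "HOL-Number_Theory.Totient" "HOL-Computational_Algebra.Squarefree"
begin

text \<open>
  Sort the matrices by the maximum \<open>m\<close> of the absolute values of their entries. Up to matrices in
  which two entries attain the maximum, symmetry reduces to \<open>a = \<plusminus>m\<close>, and such matrices correspond to
  pairs \<open>(b, c)\<close> in \<open>[-m, m]\<^sup>2\<close> with \<open>m | n + b c\<close> and \<open>n + b c \<le> m\<^sup>2\<close>. Over a double residue system
  the congruence has exactly \<open>4 \<Sum>\<^bsub>g | gcd(m, n)\<^esub> g \<phi>(m/g)\<close> solutions. Ties in a row or column need
  \<open>m | n\<close>, and contribute \<open>O(\<sigma>\<^sub>0(n) X)\<close>. Ties on a diagonal, and pairs with \<open>n + b c > m\<^sup>2\<close>, force \<open>b\<close> to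
  lie within \<open>n/m\<close> of \<open>\<plusminus>m\<close>, and contribute \<open>O(n (1 + ln X)\<^sup>2)\<close>. Summing over \<open>m\<close> turns the
  main term into \<open>32 \<Sum>\<^bsub>g | n\<^esub> g \<Phi>(X/g)\<close>, where
  \<open>\<Phi>(Y) = \<Sum>\<^bsub>k \<le> Y\<^esub> \<phi>(k) = 3 Y\<^sup>2 / \<pi>\<^sup>2 + O(Y (1 + ln Y))\<close>.
\<close>

section \<open>Sums over divisors\<close>

text \<open>Both sides run over the pairs \<open>(d, k)\<close> of positive integers with
  \<open>d * k <= N\<close>, grouped by \<open>d\<close> on the left and by the product
  \<open>m = d * k\<close> on the right.\<close>

lemma sum_divisors_hyperbola:
  fixes f :: "nat \<Rightarrow> nat \<Rightarrow> 'a::comm_monoid_add"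
  shows "(\<Sum>d=1..N. \<Sum>k=1..N div d. f d k) = (\<Sum>m=1..N. \<Sum>d | d dvd m. f d (m div d))"
proof -
  have le: "b \<le> N" if "Suc 0 \<le> k" "b * k \<le> N" for b k
    using that by (cases k) auto
  have "(\<Sum>d=1..N. \<Sum>k=1..N div d. f d k) = (\<Sum>(d,k)\<in>(SIGMA d:{1..N}. {1..N div d}). f d k)"
    by (rule sum.Sigma) auto
  also have "\<dots> = (\<Sum>(m,d)\<in>(SIGMA m:{1..N}. {d. d dvd m}). f d (m div d))"
    by (rule sum.reindex_bij_witness[of _ "\<lambda>(m,d). (d, m div d)" "\<lambda>(d,k). (d * k, d)"])
       (auto simp: div_le_mono less_eq_div_iff_mult_less_eq mult.commute
             intro: le dest: dvd_imp_le elim!: dvdE)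
  also have "\<dots> = (\<Sum>m=1..N. \<Sum>d | d dvd m. f d (m div d))"
    by (rule sum.Sigma[symmetric]) auto
  finally show ?thesis .
qed

section \<open>The Moebius function and divisor sums of the totient\<close>

definition moebius :: "nat \<Rightarrow> real" where
  "moebius n = (if squarefree n then (-1) ^ card (prime_factors n) else 0)"

lemma abs_moebius_le: "\<bar>moebius n\<bar> \<le> 1"
  by (simp add: moebius_def power_abs)

lemma moebius_prime_mult:
  assumes p: "prime p" and d: "\<not> p dvd d"
  shows "moebius (p * d) = - moebius d"
proof -
  have d0: "d > 0" using d by (cases d) auto
  have cop: "coprime p d" using p d by (simp add: prime_imp_coprime)
  have "squarefree (p * d) \<longleftrightarrow> squarefree d"
    using squarefree_mult_coprime[OF cop] squarefree_prime[OF p] squarefree_multD by blast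
  moreover have "prime_factors (p * d) = insert p (prime_factors d)"
    using p d0 by (subst prime_factors_product) (auto simp: prime_prime_factors)
  moreover have "p \<notin> prime_factors d" using d by auto
  ultimately show ?thesis by (simp add: moebius_def)
qed

text \<open>For a prime \<open>p\<close> dividing \<open>n\<close>, multiplication by
  \<open>p\<close> matches the squarefree divisors prime to \<open>p\<close> with those divisible by
  \<open>p\<close>, and it reverses the sign of \<open>moebius\<close>.\<close>

lemma sum_moebius_divisors:
  assumes "n > 0"
  shows "(\<Sum>d | d dvd n. moebius d) = (if n = 1 then 1 else 0)"
proof (cases "n = 1")
  case True
  then show ?thesis by (simp add: moebius_def)
next
  case False
  then obtain p where p: "prime p" "p dvd n" using prime_factor_nat by blast
  let ?A = "{d. d dvd n \<and> squarefree d \<and> \<not> p dvd d}"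
  let ?B = "{d. d dvd n \<and> squarefree d \<and> p dvd d}"
  have fin: "finite {d. d dvd n}" using assms by simp
  have fA: "finite ?A" and fB: "finite ?B" by (rule finite_subset[OF _ fin], blast)+
  have p0: "p > 0" using p by (simp add: prime_gt_0_nat)
  have "(\<Sum>d | d dvd n. moebius d) = (\<Sum>d\<in>?A \<union> ?B. moebius d)"
    by (rule sum.mono_neutral_right[OF fin]) (auto simp: moebius_def)
  also have "\<dots> = (\<Sum>d\<in>?A. moebius d) + (\<Sum>d\<in>?B. moebius d)"
    by (rule sum.union_disjoint[OF fA fB]) auto
  also have "(\<Sum>d\<in>?B. moebius d) = (\<Sum>d\<in>?A. moebius (p * d))"
  proof (rule sum.reindex_bij_witness[of _ "\<lambda>d. p * d" "\<lambda>d. d div p"])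
    fix d assume d: "d \<in> ?B"
    then obtain e where e: "d = p * e" by auto
    have "\<not> p dvd e"
    proof
      assume "p dvd e"
      then have "p\<^sup>2 dvd d" by (auto simp: e power2_eq_square)
      then show False using d p squarefreeD[of d p] by auto
    qed
    then show "d div p \<in> ?A" using d e p0 squarefree_multD by (auto intro: dvd_mult_right)
    show "p * (d div p) = d" using e p0 by simp
    then show "moebius (p * (d div p)) = moebius d" by simp
  next
    fix d assume d: "d \<in> ?A"
    then have cop: "coprime p d" using p by (simp add: prime_imp_coprime)
    show "p * d div p = d" using p0 by simp
    show "p * d \<in> ?B"
      using d p cop by (auto intro: divides_mult squarefree_mult_coprime squarefree_prime)
  qed
  also have "\<dots> = - (\<Sum>d\<in>?A. moebius d)"
    unfolding sum_negf[symmetric] by (rule sum.cong) (auto simp: moebius_prime_mult p)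
  finally show ?thesis using False by simp
qed

text \<open>Grouping by the product \<open>m\<close> makes the inner sum Gauss's identity: the
  totients of the divisors of \<open>m\<close> add up to \<open>m\<close>.\<close>

lemma sum_totient_quotients:
  "(\<Sum>d=1..N. \<Sum>k=1..N div d. totient k) = N * (N + 1) div 2"
proof -
  have "(\<Sum>d=1..N. \<Sum>k=1..N div d. totient k) = (\<Sum>m=1..N. \<Sum>d | d dvd m. totient (m div d))"
    by (rule sum_divisors_hyperbola)
  also have "\<dots> = (\<Sum>m=1..N. m)"
  proof (rule sum.cong[OF refl])
    fix m assume "m \<in> {1..N}"
    then have "(\<Sum>d | d dvd m. totient (m div d)) = (\<Sum>d | d dvd m. totient d)"
      by (intro sum.reindex_bij_witness[of _ "\<lambda>d. m div d" "\<lambda>d. m div d"]) (auto elim!: dvdE)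
    then show "(\<Sum>d | d dvd m. totient (m div d)) = m" by (simp add: totient_divisor_sum)
  qed
  also have "\<dots> = N * (N + 1) div 2" using Sum_Icc_nat[of 1 N] by simp
  finally show ?thesis .
qed

section \<open>Harmonic sums, inverse squares and the summatory totient\<close>

lemma harm_le: "N \<ge> 1 \<Longrightarrow> (harm N :: real) \<le> 1 + ln (real N)"
proof (induction N rule: nat_induct_at_least)
  case base
  then show ?case by (simp add: harm_expand)
next
  case (Suc N)
  \<comment> \<open>The bound \<open>ln t <= t - 1\<close> at \<open>t = N / (N + 1)\<close>
    compares one harmonic term with the increment of the logarithm.\<close>
  have "ln (real N / real (Suc N)) \<le> real N / real (Suc N) - 1"
    using Suc by (intro ln_le_minus_one) simp
  also have "\<dots> = - inverse (real (Suc N))" by (simp add: field_simps)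
  finally have "inverse (real (Suc N)) \<le> ln (real (Suc N)) - ln (real N)"
    using Suc by (simp add: ln_div)
  then show ?case using Suc by (simp add: harm_Suc)
qed

text \<open>Adding the tail estimate \<open>1 / K\<close> makes the partial sums nonincreasing,
  since \<open>1 / (N + 1)^2 + 1 / (N + 1) <= 1 / N\<close>; so each corrected sum bounds the limit
  from above.\<close>

lemma sum_inverse_squares_bounds:
  shows "(\<Sum>d=1..K. 1 / real d ^ 2) \<le> pi\<^sup>2 / 6"
    and "K \<ge> 1 \<Longrightarrow> pi\<^sup>2 / 6 \<le> (\<Sum>d=1..K. 1 / real d ^ 2) + 1 / K"
proof -
  have S: "(\<lambda>n. 1 / (real n + 1)\<^sup>2) sums (pi\<^sup>2 / 6)"
    using inverse_squares_sums by (simp add: add_ac)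
  have eq: "(\<Sum>d=1..K. 1 / real d ^ 2) = (\<Sum>n<K. 1 / (real n + 1)\<^sup>2)" for K
    by (rule sum.reindex_bij_witness[of _ "\<lambda>n. n + 1" "\<lambda>d. d - 1"]) (auto simp: of_nat_diff)
  show "(\<Sum>d=1..K. 1 / real d ^ 2) \<le> pi\<^sup>2 / 6"
    unfolding eq using sum_le_suminf[of "\<lambda>n. 1 / (real n + 1)\<^sup>2" "{..<K}"] S
    by (auto simp: sums_iff)
  assume K: "K \<ge> 1"
  have step: "(\<Sum>d=1..N. 1 / real d ^ 2) + 1 / N \<le> (\<Sum>d=1..K. 1 / real d ^ 2) + 1 / K" if "N \<ge> K" for N
    using that
  proof (induction N rule: dec_induct)
    case (step N)
    have "N > 0" using step K by simp
    then have "1 / real (Suc N) ^ 2 + 1 / real (Suc N) \<le> 1 / real N"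
      by (simp add: divide_simps power2_eq_square) (simp add: algebra_simps)
    then show ?case using step by simp
  qed simp
  have "(\<lambda>N. \<Sum>d=1..N. 1 / real d ^ 2) \<longlonglongrightarrow> pi\<^sup>2 / 6"
    unfolding eq using S by (simp add: sums_def)
  then show "pi\<^sup>2 / 6 \<le> (\<Sum>d=1..K. 1 / real d ^ 2) + 1 / K"
  proof (rule LIMSEQ_le_const2)
    show "\<exists>M. \<forall>N\<ge>M. (\<Sum>d=1..N. 1 / real d ^ 2) \<le> (\<Sum>d=1..K. 1 / real d ^ 2) + 1 / K"
    proof (intro exI allI impI)
      fix N assume "N \<ge> K"
      have "0 \<le> 1 / real N" by simp
      then show "(\<Sum>d=1..N. 1 / real d ^ 2) \<le> (\<Sum>d=1..K. 1 / real d ^ 2) + 1 / K"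
        using step[OF \<open>N \<ge> K\<close>] by linarith
    qed
  qed
qed

text \<open>With \<open>\<Phi>\<close> the summatory function of the totient, \<open>\<Sum>\<^sub>d \<Phi>(N div d)\<close> is a triangular number.
  So the deviation of \<open>\<Phi>\<close> from its main term sums to \<open>O(N/e)\<close> over the multiples of each \<open>e\<close>,
  and Moebius inversion gives the bound for \<open>\<Phi>(N)\<close> itself.\<close>

lemma sum_totient_asymp:
  assumes N: "N \<ge> 1"
  shows "\<bar>real (\<Sum>k=1..N. totient k) - 3 / pi\<^sup>2 * real N ^ 2\<bar> \<le> 3 * real N * (1 + ln N)"
proof -
  define c :: real where "c = 3 / pi\<^sup>2"
  define T :: "nat \<Rightarrow> real" where "T K = real (\<Sum>k=1..K. totient k)" for K
  \<comment> \<open>\<open>G k\<close> is the deviation at \<open>N / k\<close>. Its main term uses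
    the exact quotient rather than the floor, so that summing over multiples produces inverse
    squares. The quantity to be bounded is \<open>G 1\<close>.\<close>
  define G where "G k = T (N div k) - c * (real N / k) ^ 2" for k
  have c0: "c > 0" by (simp add: c_def)
  have c1: "c \<le> 1" using pi_ge_two mult_mono[of 2 pi 2 pi] by (simp add: c_def power2_eq_square)
  \<comment> \<open>The totient part over multiples of \<open>e\<close> is the triangular number of
    \<open>K\<close>, about \<open>y^2 / 2\<close>. The main terms also give about
    \<open>y^2 / 2\<close>, because \<open>c\<close> times the sum of all inverse squares is
    \<open>1 / 2\<close>.\<close>
  have F: "\<bar>\<Sum>d=1..N div e. G (e * d)\<bar> \<le> 3 * (real N / e)" if e: "1 \<le> e" "e \<le> N" for e
  proof -
    define K where "K = N div e"
    define y where "y = real N / e"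
    define Z where "Z = (\<Sum>d=1..K. 1 / real d ^ 2)"
    have K1: "K \<ge> 1" using e by (simp add: K_def div_greater_zero_iff Suc_leI)
    have "N = K * e + N mod e" "N mod e < e" using e by (simp_all add: K_def)
    then have "K * e \<le> N" "N \<le> (K + 1) * e" by (simp_all add: algebra_simps)
    then have "real K * e \<le> N" "N \<le> (real K + 1) * e"
      by (metis of_nat_mult of_nat_le_iff) (metis of_nat_mult of_nat_le_iff of_nat_add of_nat_1 \<open>N \<le> (K + 1) * e\<close>)
    then have Ky: "real K \<le> y" and yK: "y \<le> real K + 1"
      using e by (simp_all add: y_def field_simps)
    have "(\<Sum>d=1..K. G (e * d)) = (\<Sum>d=1..K. T (K div d)) - c * y ^ 2 * Z"
    proof -
      \<comment> \<open>Nested floors compose: \<open>N div (e * d) = K div d\<close>.\<close>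
      have "G (e * d) = T (K div d) - c * y ^ 2 * (1 / real d ^ 2)" for d
        by (simp add: G_def K_def y_def div_mult2_eq power_divide power_mult_distrib)
      then show ?thesis by (simp add: sum_subtractf Z_def sum_distrib_left)
    qed
    also have "(\<Sum>d=1..K. T (K div d)) = real (K * (K + 1) div 2)"
      unfolding T_def using sum_totient_quotients[of K] by (metis of_nat_sum)
    also have "real (K * (K + 1) div 2) = real K * (real K + 1) / 2"
      by (subst real_of_nat_div) (auto simp: algebra_simps)
    finally have eq: "(\<Sum>d=1..K. G (e * d)) = real K * (real K + 1) / 2 - c * y ^ 2 * Z" .
    have Z1: "Z \<le> pi\<^sup>2 / 6" and Z2: "pi\<^sup>2 / 6 \<le> Z + 1 / K"
      using sum_inverse_squares_bounds[of K] K1 by (auto simp: Z_def)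
    have cpi: "c * y ^ 2 * (pi\<^sup>2 / 6) = y ^ 2 / 2" by (simp add: c_def)
    have U: "c * y ^ 2 * Z \<le> y ^ 2 / 2"
      using mult_left_mono[OF Z1, of "c * y ^ 2"] c0 unfolding cpi by simp
    have "y ^ 2 / 2 \<le> c * y ^ 2 * Z + c * y ^ 2 * (1 / K)"
      using mult_left_mono[OF Z2, of "c * y ^ 2"] c0 unfolding cpi distrib_left by simp
    \<comment> \<open>This is the cost of truncating the series at \<open>K\<close>; it is linear in
      \<open>y\<close> because \<open>y <= K + 1 <= 2 * K\<close>.\<close>
    moreover have "c * y ^ 2 * (1 / K) \<le> 2 * y"
    proof -
      have "c * (y * y) \<le> 1 * (y * (2 * K))"
        using c0 c1 Ky yK K1 by (intro mult_mono) auto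
      then show ?thesis using K1 by (simp add: field_simps power2_eq_square)
    qed
    ultimately have L: "y ^ 2 / 2 \<le> c * y ^ 2 * Z + 2 * y" by linarith
    \<comment> \<open>The deviation then lies between \<open>- y / 2\<close> and
      \<open>y / 2 + 2 * y\<close>, which explains the constant 3.\<close>
    have "real K * (real K + 1) \<le> y * (y + 1)" using Ky by (intro mult_mono) auto
    moreover have "y * (y - 1) \<le> (real K + 1) * real K" 
      using Ky yK K1 by (intro mult_mono) auto
    moreover have "y * (y + 1) = y ^ 2 + y" "y * (y - 1) = y ^ 2 - y" "(real K + 1) * real K = real K * (real K + 1)"
      by (simp_all add: algebra_simps power2_eq_square)
    ultimately show ?thesis
      using U L eq Ky K1 unfolding K_def[symmetric] y_def[symmetric] abs_le_iff by linarith
  qed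
  \<comment> \<open>Moebius inversion: \<open>G m\<close> is weighted by the sum of
    \<open>moebius\<close> over the divisors of \<open>m\<close>, so only \<open>G 1\<close>
    survives.\<close>
  have "(\<Sum>e=1..N. moebius e * (\<Sum>d=1..N div e. G (e * d)))
      = (\<Sum>e=1..N. \<Sum>d=1..N div e. moebius e * G (e * d))"
    by (simp add: sum_distrib_left)
  also have "\<dots> = (\<Sum>m=1..N. \<Sum>e | e dvd m. moebius e * G (e * (m div e)))"
    by (rule sum_divisors_hyperbola)
  also have "\<dots> = (\<Sum>m=1..N. if m = 1 then G 1 else 0)"
  proof (rule sum.cong[OF refl])
    fix m assume m: "m \<in> {1..N}"
    have "(\<Sum>e | e dvd m. moebius e * G (e * (m div e))) = (\<Sum>e | e dvd m. moebius e) * G m"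
      by (simp add: sum_distrib_right)
    then show "(\<Sum>e | e dvd m. moebius e * G (e * (m div e))) = (if m = 1 then G 1 else 0)"
      using m by (simp add: sum_moebius_divisors)
  qed
  also have "\<dots> = G 1" using N by (simp add: sum.delta)
  finally have "\<bar>G 1\<bar> = \<bar>\<Sum>e=1..N. moebius e * (\<Sum>d=1..N div e. G (e * d))\<bar>" by simp
  also have "\<dots> \<le> (\<Sum>e=1..N. \<bar>moebius e * (\<Sum>d=1..N div e. G (e * d))\<bar>)" by (rule sum_abs)
  also have "\<dots> \<le> (\<Sum>e=1..N. 3 * (real N / e))"
  proof (rule sum_mono)
    fix e assume e: "e \<in> {1..N}"
    then show "\<bar>moebius e * (\<Sum>d=1..N div e. G (e * d))\<bar> \<le> 3 * (real N / e)"
      unfolding abs_mult using mult_mono[OF abs_moebius_le[of e] F[of e]] by simp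
  qed
  also have "\<dots> = 3 * real N * harm N"
    by (simp add: harm_def sum_distrib_left field_simps)
  also have "\<dots> \<le> 3 * real N * (1 + ln N)"
    by (intro mult_left_mono harm_le N) auto
  finally show ?thesis by (simp add: G_def T_def c_def)
qed

text \<open>Summing over \<open>g\<close> first gives \<open>g\<close> times the summatory totient
  at \<open>M div g\<close>, for each \<open>g\<close> dividing \<open>n\<close>. Its main term is
  proportional to \<open>M^2 / g\<close>, whence \<open>divisor_sigma (-1) n\<close>; the error is
  of the same size for every \<open>g\<close>, whence \<open>divisor_sigma 0 n\<close>.\<close>

lemma sum_gcd_totient_asymp:
  assumes n: "n \<ge> 1" and M: "M \<ge> 1"
  shows "\<bar>real (\<Sum>m=1..M. \<Sum>g | g dvd m \<and> g dvd n. g * totient (m div g))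
            - 3 / pi\<^sup>2 * divisor_sigma (-1) n * real M ^ 2\<bar>
         \<le> 6 * divisor_sigma 0 n * real M * (1 + ln M)"
proof -
  define c :: real where "c = 3 / pi\<^sup>2"
  define T :: "nat \<Rightarrow> real" where "T K = real (\<Sum>k=1..K. totient k)" for K
  have c0: "c > 0" by (simp add: c_def)
  have c1: "c \<le> 1" using pi_ge_two mult_mono[of 2 pi 2 pi] by (simp add: c_def power2_eq_square)
  have fin: "finite {g. g dvd n}" using n by simp
  have lnM: "ln (real M) \<ge> 0" using M by simp
  have "(\<Sum>m=1..M. \<Sum>g | g dvd m \<and> g dvd n. g * totient (m div g))
      = (\<Sum>m=1..M. \<Sum>g | g dvd m. if g dvd n then g * totient (m div g) else 0)"
  proof (rule sum.cong[OF refl])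
    fix m assume "m \<in> {1..M}"
    then have "finite {g. g dvd m}" by simp
    then show "(\<Sum>g | g dvd m \<and> g dvd n. g * totient (m div g))
        = (\<Sum>g | g dvd m. if g dvd n then g * totient (m div g) else 0)"
      by (subst sum.inter_filter[symmetric]) auto
  qed
  also have "\<dots> = (\<Sum>g=1..M. \<Sum>k=1..M div g. if g dvd n then g * totient k else 0)"
    by (rule sum_divisors_hyperbola[symmetric])
  also have "\<dots> = (\<Sum>g=1..M. if g dvd n then g * (\<Sum>k=1..M div g. totient k) else 0)"
    by (rule sum.cong) (auto simp: sum_distrib_left)
  also have "\<dots> = (\<Sum>g | g \<in> {1..M} \<and> g dvd n. g * (\<Sum>k=1..M div g. totient k))"
    by (subst sum.inter_filter[symmetric]) auto
  also have "\<dots> = (\<Sum>g | g dvd n. g * (\<Sum>k=1..M div g. totient k))"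
    \<comment> \<open>Divisors \<open>g > M\<close> may be added: there \<open>M div g = 0\<close>
      and the inner sum is empty.\<close>
    using n by (intro sum.mono_neutral_left fin) (auto simp: div_eq_0_iff intro: ccontr)
  finally have eq: "real (\<Sum>m=1..M. \<Sum>g | g dvd m \<and> g dvd n. g * totient (m div g))
      = (\<Sum>g | g dvd n. real g * T (M div g))"
    by (simp add: T_def)
  have summand: "\<bar>real g * T (M div g) - c * (real M ^ 2 / g)\<bar> \<le> 6 * real M * (1 + ln M)"
    if "g dvd n" for g
  proof -
    have g: "g \<ge> 1" using that n by (cases g) auto
    define K where "K = M div g"
    define y where "y = real M / g"
    have gy: "real g * y = M" using g by (simp add: y_def)
    have "M = K * g + M mod g" "M mod g < g" using g by (simp_all add: K_def)
    then have "K * g \<le> M" "M \<le> (K + 1) * g" by (simp_all add: algebra_simps)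
    then have "real K * g \<le> M" "M \<le> (real K + 1) * g"
      by (metis of_nat_mult of_nat_le_iff) (metis of_nat_mult of_nat_le_iff of_nat_add of_nat_1 \<open>M \<le> (K + 1) * g\<close>)
    then have Ky: "real K \<le> y" and yK: "y \<le> real K + 1"
      using g by (simp_all add: y_def field_simps)
    have y0: "y \<ge> 0" by (simp add: y_def)
    have T: "\<bar>T K - c * real K ^ 2\<bar> \<le> 3 * y * (1 + ln M)"
    proof (cases "K = 0")
      case True
      then show ?thesis using y0 lnM by (simp add: T_def)
    next
      case False
      have "K \<le> M" by (simp add: K_def)
      then have "ln (real K) \<le> ln (real M)" using False by simp
      then have "3 * real K * (1 + ln K) \<le> 3 * y * (1 + ln M)"
        using Ky False by (intro mult_mono) auto
      then show ?thesis using sum_totient_asymp[of K] False by (simp add: T_def c_def)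
    qed
    \<comment> \<open>Passing from the floor \<open>K\<close> to \<open>y\<close> changes the square
      by at most \<open>2 * y\<close>, which adds to the error \<open>3 * y * (1 + ln M)\<close> and
      stays below the factor 6.\<close>
    have "(y - K) * (y + K) \<le> 1 * (2 * y)"
      using Ky yK by (intro mult_mono) auto
    then have "y ^ 2 - real K ^ 2 \<le> 2 * y" by (simp add: algebra_simps power2_eq_square)
    moreover have "real K ^ 2 \<le> y ^ 2" using Ky by (intro power_mono) auto
    ultimately have "c * (y ^ 2 - real K ^ 2) \<le> 1 * (2 * y)" "c * (y ^ 2 - real K ^ 2) \<ge> 0"
      using c0 c1 by (intro mult_mono mult_nonneg_nonneg; simp)+
    moreover have "y * 1 \<le> y * (1 + ln M)" using y0 lnM by (intro mult_left_mono) auto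
    ultimately have "\<bar>T K - c * y ^ 2\<bar> \<le> 6 * y * (1 + ln M)"
      using T by (simp add: algebra_simps abs_le_iff)
    then have "real g * \<bar>T K - c * y ^ 2\<bar> \<le> real g * (6 * y * (1 + ln M))"
      by (rule mult_left_mono) simp
    also have "\<dots> = 6 * real M * (1 + ln M)" using arg_cong[OF gy, of "\<lambda>t. 6 * t * (1 + ln M)"] by (simp only: mult_ac)
    also have "real g * \<bar>T K - c * y ^ 2\<bar> = \<bar>real g * T K - c * (real M ^ 2 / g)\<bar>"
    proof -
      have "real g * (T K - c * y ^ 2) = real g * T K - c * (real M ^ 2 / g)"
        using g by (simp add: y_def power2_eq_square field_simps)
      then show ?thesis by (metis abs_mult abs_of_nat)
    qed
    finally show ?thesis by (simp add: K_def)
  qed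
  have "(\<Sum>g | g dvd n. real g * T (M div g)) - c * divisor_sigma (-1) n * real M ^ 2
      = (\<Sum>g | g dvd n. real g * T (M div g) - c * (real M ^ 2 / g))"
  proof -
    have "c * divisor_sigma (-1) n * real M ^ 2 = (\<Sum>g | g dvd n. c * (real M ^ 2 / g))"
      unfolding divisor_sigma_def sum_distrib_left sum_distrib_right
      by (rule sum.cong) (auto simp: powr_minus_divide)
    then show ?thesis by (simp add: sum_subtractf)
  qed
  then have "\<bar>(\<Sum>g | g dvd n. real g * T (M div g)) - c * divisor_sigma (-1) n * real M ^ 2\<bar>
      \<le> (\<Sum>g | g dvd n. \<bar>real g * T (M div g) - c * (real M ^ 2 / g)\<bar>)"
    by (simp only: sum_abs)
  also have "\<dots> \<le> (\<Sum>g | g dvd n. 6 * real M * (1 + ln M))"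
    by (rule sum_mono) (use summand in auto)
  also have "\<dots> = 6 * divisor_sigma 0 n * real M * (1 + ln M)"
  proof -
    have "divisor_sigma 0 n = (\<Sum>g | g dvd n. 1)"
      unfolding divisor_sigma_def using n by (intro sum.cong) (auto intro!: Nat.gr0I)
    then show ?thesis by simp
  qed
  finally show ?thesis unfolding eq c_def .
qed

text \<open>The gcd is at most the sum of the common divisors \<open>g\<close>. With
  \<open>m = g * j\<close> and \<open>k = g * i\<close> the condition reads
  \<open>g * g * j * i < n\<close>, leaving at most \<open>n / (g * g * j)\<close> values of
  \<open>i\<close>; the weight \<open>g\<close> turns this into \<open>n / (g * j)\<close>, and two
  harmonic sums remain. The lemma controls the residue pairs whose fourth entry exceeds
  \<open>m\<close>.\<close>

lemma sum_gcd_below_hyperbola: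
  fixes n M :: nat
  assumes M: "M \<ge> 1"
  shows "real (\<Sum>m=1..M. \<Sum>k | k \<in> {1..m} \<and> m * k < n. gcd k m) \<le> n * (1 + ln M) ^ 2"
proof -
  have "(\<Sum>m=1..M. \<Sum>k | k \<in> {1..m} \<and> m * k < n. gcd k m)
      \<le> (\<Sum>m=1..M. \<Sum>g | g dvd m. g * card {k. k \<ge> 1 \<and> g dvd k \<and> m * k < n})"
  proof (rule sum_mono)
    fix m assume m: "m \<in> {1..M}"
    let ?S = "{k. k \<in> {1..m} \<and> m * k < n}"
    have finS: "finite ?S" by simp
    have finm: "finite {g. g dvd m}" using m by simp
    have "(\<Sum>k\<in>?S. gcd k m) \<le> (\<Sum>k\<in>?S. \<Sum>g | g dvd m. if g dvd k then g else 0)"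
    proof (rule sum_mono)
      fix k
      have "gcd k m = (\<Sum>g\<in>{gcd k m}. if g dvd k then g else 0)" by simp
      also have "\<dots> \<le> (\<Sum>g | g dvd m. if g dvd k then g else 0)"
        by (rule sum_mono2[OF finm]) auto
      finally show "gcd k m \<le> (\<Sum>g | g dvd m. if g dvd k then g else 0)" .
    qed
    also have "\<dots> = (\<Sum>g | g dvd m. \<Sum>k\<in>?S. if g dvd k then g else 0)" by (rule sum.swap)
    also have "\<dots> \<le> (\<Sum>g | g dvd m. g * card {k. k \<ge> 1 \<and> g dvd k \<and> m * k < n})"
    proof (rule sum_mono)
      fix g
      have "(\<Sum>k\<in>?S. if g dvd k then g else 0) = (\<Sum>k | k \<in> ?S \<and> g dvd k. g)"
        using sum.inter_filter[OF finS, of "\<lambda>_. g" "\<lambda>k. g dvd k"] by simp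
      also have "\<dots> = g * card {k. k \<in> ?S \<and> g dvd k}" by simp
      also have "\<dots> \<le> g * card {k. k \<ge> 1 \<and> g dvd k \<and> m * k < n}"
      proof (intro mult_left_mono card_mono)
        have "k < n" if "m * k < n" for k
          using that m by (cases m) auto
        then have "{k. k \<ge> 1 \<and> g dvd k \<and> m * k < n} \<subseteq> {..<n}" by auto
        then show "finite {k. k \<ge> 1 \<and> g dvd k \<and> m * k < n}"
          by (rule finite_subset) simp
      qed auto
      finally show "(\<Sum>k\<in>?S. if g dvd k then g else 0) \<le> g * card {k. k \<ge> 1 \<and> g dvd k \<and> m * k < n}" .
    qed
    finally show "(\<Sum>k\<in>?S. gcd k m) \<le> (\<Sum>g | g dvd m. g * card {k. k \<ge> 1 \<and> g dvd k \<and> m * k < n})" .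
  qed
  also have "\<dots> = (\<Sum>m=1..M. \<Sum>g | g dvd m. g * card {k. k \<ge> 1 \<and> g dvd k \<and> g * (m div g) * k < n})"
    by (intro sum.cong refl) auto
  also have "\<dots> = (\<Sum>g=1..M. \<Sum>j=1..M div g. g * card {k. k \<ge> 1 \<and> g dvd k \<and> g * j * k < n})"
    by (rule sum_divisors_hyperbola[symmetric])
  finally have "real (\<Sum>m=1..M. \<Sum>k | k \<in> {1..m} \<and> m * k < n. gcd k m)
      \<le> real (\<Sum>g=1..M. \<Sum>j=1..M div g. g * card {k. k \<ge> 1 \<and> g dvd k \<and> g * j * k < n})"
    by (rule of_nat_mono)
  also have "\<dots> = (\<Sum>g=1..M. \<Sum>j=1..M div g. real (g * card {k. k \<ge> 1 \<and> g dvd k \<and> g * j * k < n}))"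
    by simp
  also have "\<dots> \<le> (\<Sum>g=1..M. \<Sum>j=1..M div g. n * (inverse (real g) * inverse (real j)))"
  proof (intro sum_mono)
    fix g j assume gj: "g \<in> {1..M}" "j \<in> {1..M div g}"
    have "{k. k \<ge> 1 \<and> g dvd k \<and> g * j * k < n} \<subseteq> (\<lambda>i. g * i) ` {1..n div (g * g * j)}"
      using gj by (auto elim!: dvdE simp: less_eq_div_iff_mult_less_eq algebra_simps)
    then have "card {k. k \<ge> 1 \<and> g dvd k \<and> g * j * k < n} \<le> card ((\<lambda>i. g * i) ` {1..n div (g * g * j)})"
      by (intro card_mono) auto
    also have "\<dots> \<le> n div (g * g * j)" using card_image_le[of "{1..n div (g * g * j)}"] by simp
    finally have "real (card {k. k \<ge> 1 \<and> g dvd k \<and> g * j * k < n}) \<le> real n / real (g * g * j)"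
      by (meson of_nat_mono order_trans of_nat_div_le_of_nat) 
    then have "real g * card {k. k \<ge> 1 \<and> g dvd k \<and> g * j * k < n} \<le> real g * (real n / real (g * g * j))"
      by (rule mult_left_mono) simp
    also have "\<dots> = n * (inverse (real g) * inverse (real j))" using gj by (simp add: field_simps)
    finally show "real (g * card {k. k \<ge> 1 \<and> g dvd k \<and> g * j * k < n})
        \<le> n * (inverse (real g) * inverse (real j))" by simp
  qed
  \<comment> \<open>Enlarging the range of \<open>j\<close> lets the double sum factor.\<close>
  also have "\<dots> \<le> (\<Sum>g=1..M. \<Sum>j=1..M. n * (inverse (real g) * inverse (real j)))"
    by (intro sum_mono sum_mono2) (auto intro: order_trans[OF _ div_le_dividend])
  also have "\<dots> = n * (harm M * harm M)"
    by (simp add: harm_def sum_distrib_left sum_distrib_right mult_ac)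
  also have "\<dots> \<le> n * ((1 + ln M) * (1 + ln M))"
    using harm_le[OF M] M by (intro mult_left_mono mult_mono) (auto intro: harm_nonneg)
  finally show ?thesis by (simp add: power2_eq_square)
qed

section \<open>The congruence \<open>n + b c = 0\<close> modulo \<open>m\<close>\<close>

lemma card_interval_cong:
  fixes q x c0 :: int
  assumes q: "q > 0"
  shows "card {c \<in> {x<..x + int k * q}. q dvd c - c0} = k"
proof -
  \<comment> \<open>\<open>r\<close> is the least integer above \<open>x\<close> congruent to
    \<open>c0\<close> modulo \<open>q\<close>; the solutions are
    \<open>r, r + q, ..., r + (k - 1) * q\<close>.\<close>
  define r where "r = x + 1 + (c0 - x - 1) mod q"
  have r1: "x < r" "r \<le> x + q" using pos_mod_bound[OF q, of "c0 - x - 1"] pos_mod_sign[OF q, of "c0 - x - 1"]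
    unfolding r_def by linarith+
  have "q dvd (c0 - x - 1) - (c0 - x - 1) mod q" by (rule dvd_minus_mod)
  then have r2: "q dvd c0 - r" by (simp add: r_def algebra_simps)
  have "{c \<in> {x<..x + int k * q}. q dvd c - c0} = (\<lambda>j. r + int j * q) ` {..<k}"
  proof (intro equalityI subsetI)
    fix c assume c: "c \<in> {c \<in> {x<..x + int k * q}. q dvd c - c0}"
    then have "q dvd (c - c0) + (c0 - r)" using r2 by (intro dvd_add) auto
    then obtain j where j: "c = r + j * q" by (auto simp: dvd_def algebra_simps)
    have cx: "x < r + j * q" "r + j * q \<le> x + int k * q" using c unfolding j by auto
    have "(-1) * q < j * q" using cx r1 by simp
    then have "j \<ge> 0" using q mult_less_cancel_right_pos[of q "-1" j] by simp
    moreover have "j * q < int k * q" using cx r1 by linarith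
    then have "j < int k" using q mult_less_cancel_right_pos[of q j "int k"] by simp
    ultimately show "c \<in> (\<lambda>j. r + int j * q) ` {..<k}"
      using j by (intro image_eqI[of _ _ "nat j"]) auto
  next
    fix c assume "c \<in> (\<lambda>j. r + int j * q) ` {..<k}"
    then obtain j where j: "c = r + int j * q" "j < k" by auto
    have "int j * q \<ge> 0" using q by simp
    moreover have "(int j + 1) * q \<le> int k * q" using j q by (intro mult_right_mono) auto
    then have "int j * q + q \<le> int k * q" by (simp add: distrib_right)
    ultimately have "x < c" "c \<le> x + int k * q" using j r1 by linarith+
    moreover have "q dvd int j * q - (c0 - r)" by (rule dvd_diff[OF dvd_triv_right r2])
    ultimately show "c \<in> {c \<in> {x<..x + int k * q}. q dvd c - c0}"
      using j by (simp add: algebra_simps)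
  qed
  moreover have "inj_on (\<lambda>j. r + int j * q) {..<k}" using q by (auto simp: inj_on_def)
  ultimately show ?thesis by (simp add: card_image)
qed

text \<open>With \<open>g = gcd b m\<close>, solvability means that \<open>g\<close> divides
  \<open>n\<close>, and then the solutions form one residue class modulo \<open>m / g\<close>. An
  interval of length \<open>2 * m\<close> is made of \<open>2 * g\<close> periods.\<close>

lemma card_linear_congruence:
  fixes m n b :: int
  assumes m: "m > 0"
  shows "card {c \<in> {-m<..m}. m dvd n + b * c} = (if gcd b m dvd n then 2 * nat (gcd b m) else 0)"
proof (cases "gcd b m dvd n")
  case False
  have "\<not> m dvd n + b * c" for c
  proof
    assume "m dvd n + b * c"
    then have "gcd b m dvd n + b * c" by (rule dvd_trans[rotated]) simp
    moreover have "gcd b m dvd b * c" by simp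
    ultimately have "gcd b m dvd n" by (simp add: dvd_add_left_iff)
    with False show False ..
  qed
  then show ?thesis using False by simp
next
  case True
  define g where "g = gcd b m"
  have g0: "g > 0" using m by (simp add: g_def)
  obtain u v where uv: "u * b + v * m = g" using bezout_int[of b m] by (auto simp: g_def)
  obtain k where k: "n = g * k" using True by (auto simp: g_def)
  obtain b' where b': "b = g * b'" unfolding g_def by (meson dvdE gcd_dvd1)
  obtain q where q: "m = g * q" unfolding g_def by (meson dvdE gcd_dvd2)
  have q0: "q > 0" using m g0 q by (simp add: zero_less_mult_iff)
  have "gcd (g * b') (g * q) = g * 1" using g_def[symmetric] by (simp only: b'[symmetric] q[symmetric] mult_1_right)
  then have cop: "coprime q b'" using g0
    by (simp add: gcd_mult_distrib_int[symmetric] coprime_iff_gcd_eq_1 gcd.commute)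
  have "m dvd n + b * c \<longleftrightarrow> q dvd c - (- u * k)" for c
  proof -
    \<comment> \<open>By Bezout \<open>n = (u * b + v * m) * k\<close>, so
      \<open>c = - u * k\<close> is a particular solution.\<close>
    have "n + b * c = b * (c - (- u * k)) + m * (v * k)"
    proof -
      have "n = (u * b + v * m) * k" using k uv by simp
      then show ?thesis by (simp add: algebra_simps)
    qed
    then have "m dvd n + b * c \<longleftrightarrow> m dvd b * (c - (- u * k))"
      by (simp add: dvd_add_left_iff)
    also have "\<dots> \<longleftrightarrow> q dvd b' * (c - (- u * k))"
      unfolding b' q using g0 by (simp add: mult.assoc)
    also have "\<dots> \<longleftrightarrow> q dvd c - (- u * k)"
      using cop by (rule coprime_dvd_mult_right_iff)
    finally show ?thesis .
  qed
  moreover have "{-m<..m} = {-m<..-m + int (2 * nat g) * q}" using q g0 by simp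
  ultimately have "card {c \<in> {-m<..m}. m dvd n + b * c} = 2 * nat g"
    using card_interval_cong[OF q0, of "-m" "2 * nat g" "- u * k"] by simp
  then show ?thesis using True by (simp add: g_def)
qed

text \<open>For \<open>a = m\<close> the entry \<open>d\<close> is determined by \<open>(b, c)\<close>; it is an integer in the box exactly on
  \<open>small_pairs\<close>. The full residue system \<open>residue_pairs\<close> can be counted exactly.\<close>

definition residue_pairs :: "nat \<Rightarrow> nat \<Rightarrow> (int \<times> int) set" where
  "residue_pairs n m = {(b, c). b \<in> {-int m<..int m} \<and> c \<in> {-int m<..int m} \<and> int m dvd int n + b * c}"

text \<open>Each \<open>b\<close> admits \<open>2 * gcd b m\<close> values of \<open>c\<close> if
  that gcd divides \<open>n\<close>, and none otherwise. The \<open>b\<close> run through two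
  periods, and in one period the gcd equals \<open>g\<close> exactly
  \<open>totient (m div g)\<close> times.\<close>

lemma card_residue_pairs:
  assumes m: "m \<ge> 1"
  shows "card (residue_pairs n m) = 4 * (\<Sum>g | g dvd m \<and> g dvd n. g * totient (m div g))"
proof -
  define h where "h g = (if g dvd n then g else 0)" for g
  have finm: "finite {g. g dvd m}" using m by simp
  have fin: "finite {c \<in> {-int m<..int m}. P c}" for P
    by (rule finite_subset[of _ "{-int m<..int m}"]) auto
  have R: "residue_pairs n m = Sigma {-int m<..int m} (\<lambda>b. {c \<in> {-int m<..int m}. int m dvd int n + b * c})"
    by (auto simp: residue_pairs_def)
  have "card (residue_pairs n m)
      = (\<Sum>b\<in>{-int m<..int m}. card {c \<in> {-int m<..int m}. int m dvd int n + b * c})"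
    unfolding R by (rule card_SigmaI) (simp, intro ballI fin)
  also have "\<dots> = (\<Sum>b\<in>{-int m<..int m}. 2 * h (nat (gcd b (int m))))"
  proof (rule sum.cong[OF refl])
    fix b
    have "gcd b (int m) dvd int n \<longleftrightarrow> nat (gcd b (int m)) dvd n"
      by (metis gcd_ge_0_int int_dvd_int_iff int_nat_eq)
    then show "card {c \<in> {-int m<..int m}. int m dvd int n + b * c} = 2 * h (nat (gcd b (int m)))"
      using m by (subst card_linear_congruence) (auto simp: h_def)
  qed
  also have "{-int m<..int m} = {-int m<..0} \<union> {0<..int m}" by auto
  also have "(\<Sum>b\<in>{-int m<..0} \<union> {0<..int m}. 2 * h (nat (gcd b (int m))))
      = (\<Sum>b\<in>{-int m<..0}. 2 * h (nat (gcd b (int m)))) + (\<Sum>b\<in>{0<..int m}. 2 * h (nat (gcd b (int m))))"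
    by (rule sum.union_disjoint) auto
  \<comment> \<open>Translation by \<open>m\<close> carries the nonpositive period to the positive
    one and preserves the gcd.\<close>
  also have "(\<Sum>b\<in>{-int m<..0}. 2 * h (nat (gcd b (int m)))) = (\<Sum>b\<in>{0<..int m}. 2 * h (nat (gcd b (int m))))"
    by (rule sum.reindex_bij_witness[of _ "\<lambda>b. b - int m" "\<lambda>b. b + int m"]) auto
  also have "(\<Sum>b\<in>{0<..int m}. 2 * h (nat (gcd b (int m)))) = 2 * (\<Sum>k\<in>{0<..m}. h (gcd k m))"
    unfolding sum_distrib_left
    by (rule sum.reindex_bij_witness[of _ int nat]) (auto simp: gcd_int_def)
  also have "(\<Sum>k\<in>{0<..m}. h (gcd k m)) = (\<Sum>g | g dvd m. \<Sum>k | k \<in> {0<..m} \<and> gcd k m = g. h (gcd k m))"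
    by (rule sum.group[symmetric]) (use finm in auto)
  also have "\<dots> = (\<Sum>g | g dvd m. h g * totient (m div g))"
  proof (rule sum.cong[OF refl])
    fix g assume "g \<in> {g. g dvd m}"
    then have "card {k \<in> {0<..m}. gcd k m = g} = totient (m div g)"
      using m by (intro card_gcd_eq_totient) auto
    then show "(\<Sum>k | k \<in> {0<..m} \<and> gcd k m = g. h (gcd k m)) = h g * totient (m div g)"
      by simp
  qed
  also have "\<dots> = (\<Sum>g | g dvd m. if g dvd n then g * totient (m div g) else 0)"
    by (rule sum.cong) (auto simp: h_def)
  also have "\<dots> = (\<Sum>g | g dvd m \<and> g dvd n. g * totient (m div g))"
    using sum.inter_filter[OF finm, of "\<lambda>g. g * totient (m div g)" "\<lambda>g. g dvd n"] by simp
  finally show ?thesis by simp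
qed

definition small_pairs :: "nat \<Rightarrow> nat \<Rightarrow> (int \<times> int) set" where
  "small_pairs n m = {(b, c). b \<in> {-int m..int m} \<and> c \<in> {-int m..int m}
     \<and> int m dvd int n + b * c \<and> int n + b * c \<le> int m * int m}"

lemma finite_residue_pairs: "finite (residue_pairs n m)"
  by (rule finite_subset[of _ "{-int m<..int m} \<times> {-int m<..int m}"]) (auto simp: residue_pairs_def)

lemma finite_small_pairs: "finite (small_pairs n m)"
  by (rule finite_subset[of _ "{-int m..int m} \<times> {-int m..int m}"]) (auto simp: small_pairs_def)

text \<open>The closed box exceeds the half-open one only in the edges \<open>b = -m\<close> and
  \<open>c = -m\<close>. There \<open>m\<close> divides \<open>b * c\<close>, so the congruence
  forces \<open>m\<close> to divide \<open>n\<close>. Each edge has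
  \<open>2 * m + 1 <= 3 * m\<close> points.\<close>

lemma card_small_pairs_minus_residue_pairs:
  assumes m: "m \<ge> 1"
  shows "card (small_pairs n m - residue_pairs n m) \<le> (if m dvd n then 6 * m else 0)"
proof (cases "m dvd n")
  case True
  let ?I = "{-int m..int m}"
  have "small_pairs n m - residue_pairs n m \<subseteq> {-int m} \<times> ?I \<union> ?I \<times> {-int m}"
    by (auto simp: small_pairs_def residue_pairs_def)
  then have "card (small_pairs n m - residue_pairs n m) \<le> card ({-int m} \<times> ?I \<union> ?I \<times> {-int m})"
    by (intro card_mono) auto
  also have "\<dots> \<le> card ({-int m} \<times> ?I) + card (?I \<times> {-int m})" by (rule card_Un_le)
  also have "\<dots> \<le> 6 * m" using m by (simp add: card_cartesian_product)
  finally show ?thesis using True by simp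
next
  case False
  then have "small_pairs n m - residue_pairs n m = {}"
    by (auto simp: small_pairs_def residue_pairs_def dvd_add_left_iff)
       (metis dvd_add_left_iff dvd_minus_iff dvd_mult2 dvd_mult dvd_refl int_dvd_int_iff
          order_le_less minus_minus)+
  then show ?thesis by (simp only: card.empty)
qed

text \<open>If \<open>n + b * c > m^2\<close>, then \<open>m * (m - |b|) < n\<close> because
  \<open>|c| <= m\<close>. So \<open>b\<close> is \<open>m\<close> or one of the two values
  \<open>m - k\<close> and \<open>k - m\<close> with \<open>m * k < n\<close>, and each of the
  latter leaves at most \<open>2 * gcd k m\<close> choices of \<open>c\<close>.\<close>

lemma card_residue_pairs_minus_small_pairs:
  assumes m: "m \<ge> 1"
  shows "card (residue_pairs n m - small_pairs n m)
      \<le> (if m dvd n then 2 * m else 0) + 4 * (\<Sum>k | k \<in> {1..m} \<and> m * k < n. gcd k m)"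
proof -
  define C where "C b = {c \<in> {-int m<..int m}. int m dvd int n + b * c}" for b
  define K where "K = {k. k \<in> {1..m} \<and> m * k < n}"
  have finK: "finite K" by (simp add: K_def)
  have finC: "finite (C b)" for b
    by (rule finite_subset[of _ "{-int m<..int m}"]) (auto simp: C_def)
  have cardC: "card (C b) \<le> 2 * nat (gcd b (int m))" for b
    using m unfolding C_def by (subst card_linear_congruence) auto
  \<comment> \<open>The value \<open>b = m\<close> is counted exactly: a bound \<open>2 * m\<close>
    for every \<open>m\<close>, regardless of divisibility, would add up to the order of the main
    term.\<close>
  have cardCm: "card (C (int m)) = (if m dvd n then 2 * m else 0)"
    using m unfolding C_def by (subst card_linear_congruence) auto
  let ?U1 = "\<Union>k\<in>K. {int m - int k} \<times> C (int m - int k)"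
  let ?U2 = "\<Union>k\<in>K. {int k - int m} \<times> C (int k - int m)"
  have "residue_pairs n m - small_pairs n m \<subseteq> {int m} \<times> C (int m) \<union> ?U1 \<union> ?U2"
  proof
    fix x assume x: "x \<in> residue_pairs n m - small_pairs n m"
    obtain b c where bc: "x = (b, c)" by force
    have b: "-int m < b" "b \<le> int m" and c: "\<bar>c\<bar> \<le> int m" and cC: "c \<in> C b"
      and big: "int n + b * c > int m * int m"
      using x by (auto simp: bc residue_pairs_def small_pairs_def C_def)
    have "b * c \<le> \<bar>b\<bar> * \<bar>c\<bar>" by (metis abs_ge_self abs_mult)
    also have "\<dots> \<le> \<bar>b\<bar> * int m" using c by (intro mult_left_mono) auto
    finally have lt: "int m * (int m - \<bar>b\<bar>) < int n" using big by (simp add: algebra_simps)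
    consider "b = int m" | "0 \<le> b" "b < int m" | "b < 0" using b by linarith
    then show "x \<in> {int m} \<times> C (int m) \<union> ?U1 \<union> ?U2"
    proof cases
      case 1
      then show ?thesis using bc cC by auto
    next
      case 2
      define k where "k = nat (int m - b)"
      have k: "int k = int m - b" using 2 by (simp add: k_def)
      have "int (m * k) < int n" unfolding of_nat_mult k using lt 2 by simp
      then have "m * k < n" by (simp only: of_nat_less_iff)
      then have "k \<in> K" using k 2 unfolding K_def by auto
      moreover have "b = int m - int k" using k by simp
      ultimately show ?thesis using bc cC by auto
    next
      case 3
      define k where "k = nat (int m + b)"
      have k: "int k = int m + b" using 3 b by (simp add: k_def)
      have "int (m * k) < int n" unfolding of_nat_mult k using lt 3 by simp
      then have "m * k < n" by (simp only: of_nat_less_iff)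
      then have "k \<in> K" using k 3 b unfolding K_def by auto
      moreover have "b = int k - int m" using k by simp
      ultimately show ?thesis using bc cC by auto
    qed
  qed
  then have "card (residue_pairs n m - small_pairs n m) \<le> card ({int m} \<times> C (int m) \<union> ?U1 \<union> ?U2)"
    using finC finK by (intro card_mono) auto
  also have "\<dots> \<le> card ({int m} \<times> C (int m)) + card ?U1 + card ?U2"
    by (meson add_le_mono card_Un_le le_refl order_trans)
  also have "card ({int m} \<times> C (int m)) = (if m dvd n then 2 * m else 0)"
    using cardCm by (simp add: card_cartesian_product)
  also have "card ?U1 \<le> 2 * (\<Sum>k\<in>K. gcd k m)"
  proof -
    have "card ?U1 \<le> (\<Sum>k\<in>K. card ({int m - int k} \<times> C (int m - int k)))"
      by (rule card_UN_le[OF finK])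
    also have "\<dots> \<le> (\<Sum>k\<in>K. 2 * gcd k m)"
    proof (rule sum_mono)
      fix k
      have "gcd (int m - int k) (int m) = int (gcd k m)"
        by (metis gcd_diff2 gcd.commute gcd_diff1 gcd_int_int_eq)
      then show "card ({int m - int k} \<times> C (int m - int k)) \<le> 2 * gcd k m"
        using cardC[of "int m - int k"] by (simp add: card_cartesian_product)
    qed
    finally show ?thesis by (simp add: sum_distrib_left)
  qed
  also have "card ?U2 \<le> 2 * (\<Sum>k\<in>K. gcd k m)"
  proof -
    have "card ?U2 \<le> (\<Sum>k\<in>K. card ({int k - int m} \<times> C (int k - int m)))"
      by (rule card_UN_le[OF finK])
    also have "\<dots> \<le> (\<Sum>k\<in>K. 2 * gcd k m)"
    proof (rule sum_mono)
      fix k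
      have "gcd (int k - int m) (int m) = int (gcd k m)"
        by (metis gcd_diff1 gcd_int_int_eq)
      then show "card ({int k - int m} \<times> C (int k - int m)) \<le> 2 * gcd k m"
        using cardC[of "int k - int m"] by (simp add: card_cartesian_product)
    qed
    finally show ?thesis by (simp add: sum_distrib_left)
  qed
  finally show ?thesis by (simp add: K_def)
qed

section \<open>Matrices with given largest entry\<close>

definition det_quadruples :: "nat \<Rightarrow> nat \<Rightarrow> (int \<times> int \<times> int \<times> int) set" where
  "det_quadruples n m = {(a, b, c, d). {a, b, c, d} \<subseteq> {-int m..int m} \<and> a * d - b * c = int n}"

lemma finite_det_quadruples: "finite (det_quadruples n m)"
  by (rule finite_subset[of _ "{-int m..int m} \<times> {-int m..int m} \<times> {-int m..int m} \<times> {-int m..int m}"])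
     (auto simp: det_quadruples_def)

text \<open>These four sets cover the quadruples whose largest absolute value is \<open>m\<close>;
  their overlaps are the ties.\<close>

definition quad_a where "quad_a n m = {(a, b, c, d) \<in> det_quadruples n m. \<bar>a\<bar> = int m}"
definition quad_b where "quad_b n m = {(a, b, c, d) \<in> det_quadruples n m. \<bar>b\<bar> = int m}"
definition quad_c where "quad_c n m = {(a, b, c, d) \<in> det_quadruples n m. \<bar>c\<bar> = int m}"
definition quad_d where "quad_d n m = {(a, b, c, d) \<in> det_quadruples n m. \<bar>d\<bar> = int m}"

lemmas quad_defs = quad_a_def quad_b_def quad_c_def quad_d_def det_quadruples_def

lemma finite_quad:
  "finite (quad_a n m)" "finite (quad_b n m)" "finite (quad_c n m)" "finite (quad_d n m)"
  unfolding quad_a_def quad_b_def quad_c_def quad_d_def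
  by (rule finite_subset[OF _ finite_det_quadruples[of n m]]; blast)+

text \<open>Right multiplication by the quarter turn of determinant 1, and the two transpositions
  of the entries on a diagonal, permute the solutions of \<open>a d - b c = n\<close>.\<close>

definition quarter_turn :: "int \<times> int \<times> int \<times> int \<Rightarrow> int \<times> int \<times> int \<times> int" where
  "quarter_turn = (\<lambda>(a, b, c, d). (b, - a, d, - c))"

definition swap_ad :: "int \<times> int \<times> int \<times> int \<Rightarrow> int \<times> int \<times> int \<times> int" where
  "swap_ad = (\<lambda>(a, b, c, d). (d, b, c, a))"

definition swap_bc :: "int \<times> int \<times> int \<times> int \<Rightarrow> int \<times> int \<times> int \<times> int" where
  "swap_bc = (\<lambda>(a, b, c, d). (a, c, b, d))"

lemma inj_symmetries: "inj quarter_turn" "inj swap_ad" "inj swap_bc"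
  by (auto simp: inj_def quarter_turn_def swap_ad_def swap_bc_def)

lemma quarter_turn_image_quad:
  "quarter_turn ` quad_b n m = quad_a n m" "quarter_turn ` quad_a n m = quad_b n m"
  "quarter_turn ` quad_d n m = quad_c n m" "quarter_turn ` quad_c n m = quad_d n m"
proof -
  have *: "f ` A = B" if fA: "\<And>x. x \<in> A \<Longrightarrow> f x \<in> B" and gB: "\<And>x. x \<in> B \<Longrightarrow> g x \<in> A" and fg: "\<And>x. f (g x) = x"
    for f g :: "int \<times> int \<times> int \<times> int \<Rightarrow> int \<times> int \<times> int \<times> int" and A B
  proof (intro equalityI subsetI)
    show "y \<in> B" if "y \<in> f ` A" for y using that fA by blast
    show "y \<in> f ` A" if "y \<in> B" for y by (rule image_eqI[of y f "g y" A, OF fg[symmetric] gB[OF that]])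
  qed
  show "quarter_turn ` quad_b n m = quad_a n m" "quarter_turn ` quad_a n m = quad_b n m"
    "quarter_turn ` quad_d n m = quad_c n m" "quarter_turn ` quad_c n m = quad_d n m"
    \<comment> \<open>The witness is the inverse quarter turn.\<close>
    by (rule *[of _ _ _ "\<lambda>(a, b, c, d). (- b, a, - d, c)"];
        force simp: quarter_turn_def quad_defs algebra_simps)+
qed

lemma swap_image_quad:
  "swap_ad ` quad_a n m = quad_d n m" "swap_ad ` quad_b n m = quad_b n m" "swap_ad ` quad_c n m = quad_c n m"
  "swap_bc ` quad_b n m = quad_c n m" "swap_bc ` quad_a n m = quad_a n m"
proof -
  have *: "f ` A = B" if fA: "\<And>x. x \<in> A \<Longrightarrow> f x \<in> B" and gB: "\<And>x. x \<in> B \<Longrightarrow> f x \<in> A" and fg: "\<And>x. f (f x) = x"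
    for f :: "int \<times> int \<times> int \<times> int \<Rightarrow> int \<times> int \<times> int \<times> int" and A B
  proof (intro equalityI subsetI)
    show "y \<in> B" if "y \<in> f ` A" for y using that fA by blast
    show "y \<in> f ` A" if "y \<in> B" for y by (rule image_eqI[of y f "f y" A, OF fg[symmetric] gB[OF that]])
  qed
  show "swap_ad ` quad_a n m = quad_d n m" "swap_ad ` quad_b n m = quad_b n m" "swap_ad ` quad_c n m = quad_c n m"
    "swap_bc ` quad_b n m = quad_c n m" "swap_bc ` quad_a n m = quad_a n m"
    by (rule *; force simp: swap_ad_def swap_bc_def quad_defs algebra_simps)+
qed

lemma card_quad_eq:
  "card (quad_b n m) = card (quad_a n m)"
  "card (quad_c n m) = card (quad_a n m)"
  "card (quad_d n m) = card (quad_a n m)"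
  by (metis card_image inj_on_subset inj_symmetries quarter_turn_image_quad swap_image_quad subset_UNIV)+

text \<open>The symmetries leave two kinds of ties: four within a row or column, represented by
  \<open>a, b\<close>, and two on a diagonal, represented by \<open>a, d\<close>.\<close>

lemma card_quad_Int_eq:
  "card (quad_a n m \<inter> quad_c n m) = card (quad_a n m \<inter> quad_b n m)"
  "card (quad_b n m \<inter> quad_d n m) = card (quad_a n m \<inter> quad_b n m)"
  "card (quad_c n m \<inter> quad_d n m) = card (quad_a n m \<inter> quad_b n m)"
  "card (quad_b n m \<inter> quad_c n m) = card (quad_a n m \<inter> quad_d n m)"
proof -
  have im: "card (f ` A \<inter> f ` B) = card (A \<inter> B)" if "inj f" 
    for f :: "int \<times> int \<times> int \<times> int \<Rightarrow> int \<times> int \<times> int \<times> int" and A B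
    using that by (metis card_image image_Int inj_on_subset subset_UNIV)
  show 1: "card (quad_a n m \<inter> quad_c n m) = card (quad_a n m \<inter> quad_b n m)"
    using im[OF inj_symmetries(3), of "quad_a n m" "quad_b n m"] by (simp add: swap_image_quad)
  show "card (quad_b n m \<inter> quad_d n m) = card (quad_a n m \<inter> quad_b n m)"
    using im[OF inj_symmetries(2), of "quad_a n m" "quad_b n m"] by (simp add: swap_image_quad Int_commute)
  show "card (quad_c n m \<inter> quad_d n m) = card (quad_a n m \<inter> quad_b n m)"
    using im[OF inj_symmetries(2), of "quad_a n m" "quad_c n m"] 1 by (simp add: swap_image_quad Int_commute)
  show "card (quad_b n m \<inter> quad_c n m) = card (quad_a n m \<inter> quad_d n m)"
    using im[OF inj_symmetries(1), of "quad_a n m" "quad_d n m"] by (simp add: quarter_turn_image_quad)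
qed

text \<open>If \<open>m\<close> divides both \<open>a\<close> and \<open>b\<close>, it divides the
  determinant. As \<open>a\<close> is nonzero, \<open>(a, b, c)\<close> determines \<open>d\<close>,
  and there are \<open>4 * (2 * m + 1) <= 12 * m\<close> such triples.\<close>

lemma card_quad_Int_row:
  assumes m: "m \<ge> 1"
  shows "card (quad_a n m \<inter> quad_b n m) \<le> (if m dvd n then 12 * m else 0)"
proof (cases "m dvd n")
  case True
  let ?p = "\<lambda>(a, b, c, d). (a, b, c) :: int \<times> int \<times> int"
  let ?T = "{int m, -int m} \<times> {int m, -int m} \<times> {-int m..int m}"
  have "inj_on ?p (quad_a n m \<inter> quad_b n m)"
  proof (rule inj_onI)
    fix x y assume xy: "x \<in> quad_a n m \<inter> quad_b n m" "y \<in> quad_a n m \<inter> quad_b n m" "?p x = ?p y"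
    obtain a b c d where x: "x = (a, b, c, d)" by (metis prod_cases4)
    obtain d' where y: "y = (a, b, c, d')" using xy x by (cases y) auto
    have "a * d - b * c = int n" "a * d' - b * c = int n" "a \<noteq> 0"
      using xy m unfolding x y by (auto simp: quad_defs)
    then have "a * d = a * d'" "a \<noteq> 0" by linarith+
    then show "x = y" unfolding x y by simp
  qed
  moreover have "?p ` (quad_a n m \<inter> quad_b n m) \<subseteq> ?T" by (auto simp: quad_defs)
  ultimately have "card (quad_a n m \<inter> quad_b n m) \<le> card ?T" by (rule card_inj_on_le) auto
  also have "\<dots> \<le> 12 * m" using m by (simp add: card_cartesian_product)
  finally show ?thesis using True by simp
next
  case False
  have "x \<notin> quad_a n m \<inter> quad_b n m" for x
  proof
    assume x: "x \<in> quad_a n m \<inter> quad_b n m"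
    obtain a b c d where abcd: "x = (a, b, c, d)" by (metis prod_cases4)
    have "\<bar>a\<bar> = int m" "\<bar>b\<bar> = int m" and det: "a * d - b * c = int n"
      using x unfolding abcd by (auto simp: quad_defs)
    then have "int m dvd a" "int m dvd b" by (metis abs_dvd_iff dvd_refl)+
    then have "int m dvd int n" unfolding det[symmetric] by simp
    with False show False by simp
  qed
  then have "quad_a n m \<inter> quad_b n m = {}" by blast
  then show ?thesis by (simp only: card.empty)
qed

text \<open>Such a tie forces \<open>a = d\<close> and \<open>b * c = m^2 - n\<close>. If
  \<open>n < m^2\<close>, then \<open>b\<close> determines \<open>c\<close> and lies within
  \<open>n / m\<close> of \<open>m\<close> or \<open>-m\<close>. Otherwise
  \<open>m <= n div m\<close>, and a bound linear in \<open>m\<close> suffices.\<close>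

lemma card_quad_Int_diagonal:
  assumes m: "m \<ge> 1" and n: "n \<ge> 1"
  shows "card (quad_a n m \<inter> quad_d n m) \<le> 12 * (n div m) + 4"
proof -
  let ?I = "{-int m..int m}"
  define T where "T = {(b, c). b \<in> ?I \<and> c \<in> ?I \<and> b * c = int m * int m - int n}"
  have finT: "finite T" by (rule finite_subset[of _ "?I \<times> ?I"]) (auto simp: T_def)
  have "quad_a n m \<inter> quad_d n m \<subseteq> (\<lambda>(s, b, c). (s, b, c, s)) ` ({int m, -int m} \<times> T)"
  proof
    fix x assume x: "x \<in> quad_a n m \<inter> quad_d n m"
    obtain a b c d where abcd: "x = (a, b, c, d)" by (metis prod_cases4)
    have a: "a = int m \<or> a = -int m" and d: "d = int m \<or> d = -int m"
      and bc: "b \<in> ?I" "c \<in> ?I" and det: "a * d - b * c = int n"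
      using x unfolding abcd by (auto simp: quad_defs)
    have "\<bar>b * c\<bar> \<le> int m * int m" unfolding abs_mult using bc by (intro mult_mono) auto
    \<comment> \<open>The value \<open>- m^2\<close> would require \<open>b * c = - m^2 - n\<close>,
      which is out of range as \<open>n >= 1\<close>.\<close>
    then have "a * d \<noteq> - (int m * int m)" using det n by auto
    then have "d = a" using a d by auto
    moreover have "b * c = int m * int m - int n" using det a \<open>d = a\<close> by auto
    ultimately show "x \<in> (\<lambda>(s, b, c). (s, b, c, s)) ` ({int m, -int m} \<times> T)"
      using a bc unfolding abcd T_def by (intro image_eqI[of _ _ "(a, b, c)"]) auto
  qed
  then have "card (quad_a n m \<inter> quad_d n m) \<le> card ((\<lambda>(s, b, c). (s, b, c, s)) ` ({int m, -int m} \<times> T))"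
    using finT by (intro card_mono) auto
  also have "\<dots> \<le> card ({int m, -int m} \<times> T)" using finT by (intro card_image_le) auto
  also have "\<dots> = 2 * card T" using m by (simp add: card_cartesian_product)
  also have "card T \<le> 6 * (n div m) + 2"
  proof (cases "m * m \<le> n")
    case True
    then have mle: "m \<le> n div m" using m by (simp add: less_eq_div_iff_mult_less_eq)
    \<comment> \<open>The product \<open>b * c\<close> may be zero here, so \<open>b = 0\<close>
      need not determine \<open>c\<close>; it contributes at most \<open>2 * m + 1\<close>
      pairs.\<close>
    have "T \<subseteq> {0} \<times> ?I \<union> {(b, c) \<in> T. b \<noteq> 0}" by (auto simp: T_def)
    then have "card T \<le> card ({0 :: int} \<times> ?I \<union> {(b, c) \<in> T. b \<noteq> 0})"
      using finT by (intro card_mono) (auto intro: finite_subset[OF _ finT])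
    also have "\<dots> \<le> card ({0 :: int} \<times> ?I) + card {(b, c) \<in> T. b \<noteq> 0}" by (rule card_Un_le)
    also have "card {(b, c) \<in> T. b \<noteq> 0} \<le> card ?I"
    proof (rule card_inj_on_le[of fst])
      show "inj_on fst {(b, c) \<in> T. b \<noteq> 0}"
        by (auto simp: inj_on_def T_def) (metis mult_cancel_left)
    qed (auto simp: T_def)
    finally have "card T \<le> 6 * m" using m by (simp add: card_cartesian_product)
    then show ?thesis using mle by linarith
  next
    case False
    have lt: "int n < int m * int m" using False by (metis not_le of_nat_less_iff of_nat_mult)
    let ?J = "{int m - int (n div m)..int m}"
    have "card T \<le> card (?J \<union> uminus ` ?J)"
    proof (rule card_inj_on_le[of fst])
      show "inj_on fst T"
      proof (rule inj_onI)
        fix x y assume xy: "x \<in> T" "y \<in> T" "fst x = fst y"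
        obtain b c where x: "x = (b, c)" by force
        obtain c' where y: "y = (b, c')" using xy x by (cases y) auto
        have "b * c = b * c'" "b * c > 0" using xy lt unfolding x y T_def by auto
        then show "x = y" unfolding x y by auto
      qed
      show "fst ` T \<subseteq> ?J \<union> uminus ` ?J"
      proof
        fix b assume "b \<in> fst ` T"
        then obtain c where bc: "b \<in> ?I" "c \<in> ?I" "b * c = int m * int m - int n"
          by (auto simp: T_def)
        have "b * c \<le> \<bar>b\<bar> * \<bar>c\<bar>" by (metis abs_ge_self abs_mult)
        also have "\<dots> \<le> \<bar>b\<bar> * int m" using bc by (intro mult_left_mono) auto
        finally have "(int m - \<bar>b\<bar>) * int m \<le> int n" using bc by (simp add: algebra_simps)
        then have "int m - \<bar>b\<bar> \<le> int n div int m"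
          using m zdiv_mono1[of "(int m - \<bar>b\<bar>) * int m" "int n" "int m"] by simp
        then have "\<bar>b\<bar> \<in> ?J" using bc by (auto simp: zdiv_int)
        then show "b \<in> ?J \<union> uminus ` ?J" by (cases "b \<ge> 0") (auto intro: image_eqI[of _ _ "-b"])
      qed
    qed auto
    also have "\<dots> \<le> card ?J + card (uminus ` ?J)" by (rule card_Un_le)
    also have "\<dots> \<le> card ?J + card ?J" by (intro add_left_mono card_image_le) auto
    also have "\<dots> \<le> 6 * (n div m) + 2" by simp
    finally show ?thesis .
  qed
  finally show ?thesis by simp
qed

text \<open>The factor 2 is the sign \<open>s\<close> of \<open>a = s * m\<close>; the determinant
  equation then gives \<open>d = s * (n + b * c) / m\<close>.\<close>

lemma card_quad_a:
  assumes m: "m \<ge> 1" and n: "n \<ge> 1"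
  shows "card (quad_a n m) = 2 * card (small_pairs n m)"
proof -
  let ?f = "\<lambda>(s, b, c). (s * int m, b, c, s * ((int n + b * c) div int m))"
  have "bij_betw ?f ({1, -1} \<times> small_pairs n m) (quad_a n m)"
  proof (rule bij_betw_imageI)
    show "inj_on ?f ({1, -1} \<times> small_pairs n m)" using m by (auto simp: inj_on_def)
    show "?f ` ({1, -1} \<times> small_pairs n m) = quad_a n m"
    proof (intro equalityI subsetI)
      fix x assume "x \<in> ?f ` ({1, -1} \<times> small_pairs n m)"
      then obtain s b c where x: "x = ?f (s, b, c)" and s: "s = 1 \<or> s = -1"
        and bc: "(b, c) \<in> small_pairs n m" by auto
      obtain d where d: "int n + b * c = int m * d" using bc by (auto simp: small_pairs_def)
      \<comment> \<open>The lower bound on \<open>d\<close> follows from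
        \<open>b * c >= - m^2\<close>, which is why \<open>small_pairs\<close> imposes only the
        upper one.\<close>
      have "\<bar>b * c\<bar> \<le> int m * int m"
        unfolding abs_mult using bc by (intro mult_mono) (auto simp: small_pairs_def)
      then have "int m * (- int m) \<le> int m * d" unfolding d[symmetric] by simp
      then have "- int m \<le> d" using m by (simp only: mult_le_cancel_left_pos of_nat_0_less_iff)
      moreover have "int m * d \<le> int m * int m" using bc d by (simp add: small_pairs_def)
      then have "d \<le> int m" using m by simp
      moreover have "x = (s * int m, b, c, s * d)" using x d m by simp
      ultimately show "x \<in> quad_a n m"
        using s bc d by (auto simp: quad_defs small_pairs_def)
    next
      fix x assume x: "x \<in> quad_a n m"
      obtain a b c d where abcd: "x = (a, b, c, d)" by (metis prod_cases4)
      have a: "\<bar>a\<bar> = int m" and I: "b \<in> {-int m..int m}" "c \<in> {-int m..int m}" "d \<in> {-int m..int m}"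
        and det: "a * d - b * c = int n"
        using x unfolding abcd by (auto simp: quad_defs)
      have "a = 1 * int m \<or> a = (- 1) * int m" using a by linarith
      then obtain s where s: "s = 1 \<or> s = -1" "a = s * int m" by blast
      have eq: "int n + b * c = int m * (s * d)" using det s by auto
      have "s * d \<le> int m" using s I by auto
      then have "int m * (s * d) \<le> int m * int m" by (rule mult_left_mono) simp
      then have "(b, c) \<in> small_pairs n m" using I eq by (auto simp: small_pairs_def)
      moreover have "x = ?f (s, b, c)" using eq s m unfolding abcd by auto
      ultimately show "x \<in> ?f ` ({1, -1} \<times> small_pairs n m)" using s by blast
    qed
  qed
  then have "card (quad_a n m) = card ({1, -1 :: int} \<times> small_pairs n m)"
    by (rule bij_betw_same_card[symmetric])
  then show ?thesis by (simp add: card_cartesian_product)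
qed

section \<open>Bonferroni inequalities and the decomposition into shells\<close>

lemma card_Un4_bounds:
  assumes "finite A" "finite B" "finite C" "finite D"
  shows "card (A \<union> B \<union> C \<union> D) \<le> card A + card B + card C + card D"
    and "card A + card B + card C + card D \<le> card (A \<union> B \<union> C \<union> D)
       + (card (A \<inter> B) + card (A \<inter> C) + card (A \<inter> D) + card (B \<inter> C) + card (B \<inter> D) + card (C \<inter> D))"
proof -
  have 1: "card A + card B = card (A \<union> B) + card (A \<inter> B)"
    using assms by (intro card_Un_Int)
  have 2: "card (A \<union> B) + card C = card (A \<union> B \<union> C) + card ((A \<union> B) \<inter> C)"
    using assms by (intro card_Un_Int) auto
  have 3: "card (A \<union> B \<union> C) + card D = card (A \<union> B \<union> C \<union> D) + card ((A \<union> B \<union> C) \<inter> D)"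
    using assms by (intro card_Un_Int) auto
  have 4: "card ((A \<union> B) \<inter> C) \<le> card (A \<inter> C) + card (B \<inter> C)"
    by (metis Int_Un_distrib2 card_Un_le)
  have "card ((A \<union> B \<union> C) \<inter> D) \<le> card ((A \<union> B) \<inter> D) + card (C \<inter> D)"
    "card ((A \<union> B) \<inter> D) \<le> card (A \<inter> D) + card (B \<inter> D)"
    by (metis Int_Un_distrib2 card_Un_le)+
  with 1 2 3 4 show "card A + card B + card C + card D \<le> card (A \<union> B \<union> C \<union> D)
       + (card (A \<inter> B) + card (A \<inter> C) + card (A \<inter> D) + card (B \<inter> C) + card (B \<inter> D) + card (C \<inter> D))"
    by linarith
  show "card (A \<union> B \<union> C \<union> D) \<le> card A + card B + card C + card D"
    using 1 2 3 by linarith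
qed

definition shell :: "nat \<Rightarrow> nat \<Rightarrow> (int \<times> int \<times> int \<times> int) set" where
  "shell n m = quad_a n m \<union> quad_b n m \<union> quad_c n m \<union> quad_d n m"

lemma card_det_quadruples:
  assumes n: "n \<ge> 1"
  shows "card (det_quadruples n M) = (\<Sum>m=1..M. card (shell n m))"
proof (induction M)
  case 0
  have "det_quadruples n 0 = {}" using n by (auto simp: det_quadruples_def)
  then show ?case by simp
next
  case (Suc M)
  have "det_quadruples n (Suc M) = det_quadruples n M \<union> shell n (Suc M)"
    by (auto simp: shell_def quad_defs)
  moreover have "det_quadruples n M \<inter> shell n (Suc M) = {}"
    by (auto simp: shell_def quad_defs)
  moreover have "finite (shell n (Suc M))" by (simp add: shell_def finite_quad)
  ultimately have "card (det_quadruples n (Suc M)) = card (det_quadruples n M) + card (shell n (Suc M))"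
    by (simp add: card_Un_disjoint finite_det_quadruples)
  then show ?case using Suc by simp
qed

text \<open>The factor 32 is 4 positions times 2 signs times the 4 in
  \<open>card_residue_pairs\<close>. The coefficient 112 covers \<open>8 * 6\<close> from the edges
  of the box, \<open>4 * 12\<close> from row and column ties and \<open>8 * 2\<close> from
  \<open>b = m\<close>.\<close>

lemma card_shell_asymp:
  assumes m: "m \<ge> 1" and n: "n \<ge> 1"
  shows "\<bar>real (card (shell n m)) - 32 * real (\<Sum>g | g dvd m \<and> g dvd n. g * totient (m div g))\<bar>
    \<le> 112 * real (if m dvd n then m else 0) + 24 * real (n div m) + 8
       + 32 * real (\<Sum>k | k \<in> {1..m} \<and> m * k < n. gcd k m)"
proof -
  let ?S = "card (small_pairs n m)" and ?R = "card (residue_pairs n m)"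
  let ?D = "if m dvd n then m else 0" and ?E = "\<Sum>k | k \<in> {1..m} \<and> m * k < n. gcd k m"
  have up: "card (shell n m) \<le> 8 * ?S"
    using card_Un4_bounds(1)[OF finite_quad, of n m n m n m n m] card_quad_eq[of n m] card_quad_a[OF m n]
    unfolding shell_def by linarith
  have row: "card (quad_a n m \<inter> quad_b n m) \<le> 12 * ?D"
    using card_quad_Int_row[OF m, of n] by (simp split: if_splits)
  \<comment> \<open>Four row or column ties give \<open>48 * ?D\<close>, and the two diagonal ties
    give \<open>24 * (n div m) + 8\<close>.\<close>
  have low: "8 * ?S \<le> card (shell n m) + (48 * ?D + 24 * (n div m) + 8)"
    using card_Un4_bounds(2)[OF finite_quad, of n m n m n m n m] card_quad_eq[of n m] card_quad_a[OF m n]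
      card_quad_Int_eq[of n m] row card_quad_Int_diagonal[OF m n]
    unfolding shell_def by linarith
  have diff: "card A \<le> card B + card (A - B)" if "finite B" for A B :: "(int \<times> int) set"
    using that by (metis add.commute card_Un_le card_mono diff_card_le_card_Diff le_diff_conv)
  have "?S \<le> ?R + 6 * ?D"
    using diff[OF finite_residue_pairs, of "small_pairs n m" n m] 
      card_small_pairs_minus_residue_pairs[OF m, of n] by (simp split: if_splits)
  moreover have "?R \<le> ?S + (2 * ?D + 4 * ?E)"
    using diff[OF finite_small_pairs, of "residue_pairs n m" n m] 
      card_residue_pairs_minus_small_pairs[OF m, of n] by (simp split: if_splits)
  moreover have "?R = 4 * (\<Sum>g | g dvd m \<and> g dvd n. g * totient (m div g))"
    by (rule card_residue_pairs[OF m])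
  ultimately have
    "card (shell n m) \<le> 32 * (\<Sum>g | g dvd m \<and> g dvd n. g * totient (m div g))
       + (112 * ?D + 24 * (n div m) + 8 + 32 * ?E)"
    "32 * (\<Sum>g | g dvd m \<and> g dvd n. g * totient (m div g))
       \<le> card (shell n m) + (112 * ?D + 24 * (n div m) + 8 + 32 * ?E)"
    using up low by linarith+
  then have
    "real (card (shell n m)) \<le> real (32 * (\<Sum>g | g dvd m \<and> g dvd n. g * totient (m div g))
       + (112 * ?D + 24 * (n div m) + 8 + 32 * ?E))"
    "real (32 * (\<Sum>g | g dvd m \<and> g dvd n. g * totient (m div g)))
       \<le> real (card (shell n m) + (112 * ?D + 24 * (n div m) + 8 + 32 * ?E))"
    by (simp_all only: of_nat_le_iff)
  then show ?thesis
    unfolding of_nat_add of_nat_mult of_nat_numeral abs_le_iff by linarith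
qed

section \<open>Summation over the largest entry\<close>

text \<open>Integer entries are bounded by \<open>X\<close> exactly when they are bounded by its
  floor.\<close>

lemma num_det_matrices_eq_card_det_quadruples:
  assumes X: "X \<ge> 1"
  shows "num_det_matrices n X = card (det_quadruples n (nat \<lfloor>X\<rfloor>))"
proof -
  let ?f = "\<lambda>A :: int^2^2. (A $ 1 $ 1, A $ 1 $ 2, A $ 2 $ 1, A $ 2 $ 2)"
  let ?g = "\<lambda>(a, b, c, d). (vector [vector [a, b], vector [c, d]] :: int^2^2)"
  have le: "\<bar>real_of_int z\<bar> \<le> X \<longleftrightarrow> z \<in> {- int (nat \<lfloor>X\<rfloor>)..int (nat \<lfloor>X\<rfloor>)}" for z
  proof -
    have "\<bar>real_of_int z\<bar> \<le> X \<longleftrightarrow> \<bar>z\<bar> \<le> \<lfloor>X\<rfloor>" by (metis le_floor_iff of_int_abs)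
    also have "\<dots> \<longleftrightarrow> z \<in> {- int (nat \<lfloor>X\<rfloor>)..int (nat \<lfloor>X\<rfloor>)}" using X by (auto simp: abs_le_iff)
    finally show ?thesis .
  qed
  have "bij_betw ?f (bounded_det_matrices n X) (det_quadruples n (nat \<lfloor>X\<rfloor>))"
    by (rule bij_betw_byWitness[of _ ?g])
       (auto simp: bounded_det_matrices_def det_quadruples_def det_2 le forall_2 vec_eq_iff
             simp del: atLeastAtMost_iff)
  then show ?thesis unfolding num_det_matrices_def by (rule bij_betw_same_card)
qed

lemma sum_multiples_le_divisor_sigma:
  assumes n: "n \<ge> 1"
  shows "(\<Sum>m=1..M. real (if m dvd n then m else 0)) \<le> divisor_sigma 0 n * real M"
proof -
  have fin: "finite {m. m dvd n}" using n by simp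
  have "(\<Sum>m=1..M. real (if m dvd n then m else 0)) = (\<Sum>m | m \<in> {1..M} \<and> m dvd n. real m)"
    by (subst sum.inter_filter) (auto intro: sum.cong)
  also have "\<dots> \<le> (\<Sum>m | m \<in> {1..M} \<and> m dvd n. real M)" by (rule sum_mono) auto
  also have "\<dots> \<le> (\<Sum>m | m dvd n. real M)" by (rule sum_mono2[OF fin]) auto
  also have "\<dots> = (\<Sum>m | m dvd n. real m powr 0) * real M"
    unfolding sum_distrib_right using n by (intro sum.cong) (auto intro!: Nat.gr0I)
  finally show ?thesis by (simp add: divisor_sigma_def)
qed

text \<open>The second bound absorbs the change of the main term between \<open>X\<close> and its
  floor; the third moves an error into the \<open>n\<close>-term when \<open>X\<close> is close to
  1.\<close>

lemma divisor_sigma_bounds: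
  assumes n: "n \<ge> 1"
  shows "0 \<le> divisor_sigma (-1) n" "divisor_sigma (-1) n \<le> divisor_sigma 0 n" "divisor_sigma 0 n \<le> real n"
proof -
  have pos: "d \<ge> 1" if "d dvd n" for d using that n by (cases d) auto
  show "0 \<le> divisor_sigma (-1) n" by (simp add: divisor_sigma_def sum_nonneg)
  show "divisor_sigma (-1) n \<le> divisor_sigma 0 n"
    unfolding divisor_sigma_def
  proof (rule sum_mono)
    fix d assume "d \<in> {d. d dvd n}"
    then show "real d powr (-1) \<le> real d powr 0" using pos[of d] by (intro powr_mono) auto
  qed
  have "{d. d dvd n} \<subseteq> {1..n}" using pos n by (auto intro: dvd_imp_le)
  then have "card {d. d dvd n} \<le> n" using card_mono[of "{1..n}"] by fastforce
  moreover have "divisor_sigma 0 n = real (card {d. d dvd n})"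
  proof -
    have "divisor_sigma 0 n = (\<Sum>d | d dvd n. 1)"
      unfolding divisor_sigma_def using pos by (intro sum.cong) force+
    then show ?thesis by simp
  qed
  ultimately show "divisor_sigma 0 n \<le> real n" by simp
qed

lemma card_det_quadruples_asymp:
  assumes n: "n \<ge> 1" and M: "M \<ge> 1"
  shows "\<bar>real (card (det_quadruples n M)) - 96 * divisor_sigma (-1) n / pi\<^sup>2 * real M ^ 2\<bar>
    \<le> 312 * divisor_sigma 0 n * real M * (1 + ln M) + 56 * real n * (1 + ln M) ^ 2"
proof -
  define W where "W m = real (\<Sum>g | g dvd m \<and> g dvd n. g * totient (m div g))" for m
  define E where "E m = real (\<Sum>k | k \<in> {1..m} \<and> m * k < n. gcd k m)" for m
  define D where "D m = real (if m dvd n then m else 0)" for m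
  define L where "L = 1 + ln (real M)"
  have L: "L \<ge> 1" using M by (simp add: L_def)
  have sigma: "divisor_sigma 0 n \<ge> 0" using divisor_sigma_bounds[OF n] by linarith
  have "\<bar>real (card (det_quadruples n M)) - 32 * (\<Sum>m=1..M. W m)\<bar>
      = \<bar>\<Sum>m=1..M. real (card (shell n m)) - 32 * W m\<bar>"
    by (simp add: card_det_quadruples[OF n] sum_subtractf sum_distrib_left)
  also have "\<dots> \<le> (\<Sum>m=1..M. \<bar>real (card (shell n m)) - 32 * W m\<bar>)" by (rule sum_abs)
  also have "\<dots> \<le> (\<Sum>m=1..M. 112 * D m + 24 * real (n div m) + 8 + 32 * E m)"
    unfolding W_def D_def E_def by (rule sum_mono) (rule card_shell_asymp, use n in auto)
  also have "\<dots> = 112 * (\<Sum>m=1..M. D m) + 24 * (\<Sum>m=1..M. real (n div m)) + 8 * real M + 32 * (\<Sum>m=1..M. E m)"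
    by (simp add: sum.distrib sum_distrib_left)
  finally have 1: "\<bar>real (card (det_quadruples n M)) - 32 * (\<Sum>m=1..M. W m)\<bar>
      \<le> 112 * (\<Sum>m=1..M. D m) + 24 * (\<Sum>m=1..M. real (n div m)) + 8 * real M + 32 * (\<Sum>m=1..M. E m)" .
  have 2: "(\<Sum>m=1..M. D m) \<le> divisor_sigma 0 n * real M"
    unfolding D_def by (rule sum_multiples_le_divisor_sigma[OF n])
  have "(\<Sum>m=1..M. real (n div m)) \<le> (\<Sum>m=1..M. real n * inverse (real m))"
    by (intro sum_mono order_trans[OF of_nat_div_le_of_nat]) (simp add: divide_inverse)
  also have "\<dots> = real n * harm M" by (simp add: harm_def sum_distrib_left)
  also have "\<dots> \<le> real n * L" unfolding L_def by (intro mult_left_mono harm_le M) auto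
  also have "\<dots> \<le> real n * L ^ 2" using L by (intro mult_left_mono self_le_power) auto
  finally have 3: "(\<Sum>m=1..M. real (n div m)) \<le> real n * L ^ 2" .
  have 4: "(\<Sum>m=1..M. E m) \<le> real n * L ^ 2"
    using sum_gcd_below_hyperbola[OF M, of n] by (simp add: E_def L_def)
  have "\<bar>(\<Sum>m=1..M. W m) - 3 / pi\<^sup>2 * divisor_sigma (-1) n * real M ^ 2\<bar>
      \<le> 6 * divisor_sigma 0 n * real M * L"
    using sum_gcd_totient_asymp[OF n M] by (simp add: W_def L_def)
  then have 5: "\<bar>32 * (\<Sum>m=1..M. W m) - 96 * divisor_sigma (-1) n / pi\<^sup>2 * real M ^ 2\<bar>
      \<le> 192 * (divisor_sigma 0 n * real M * L)"
    by (simp add: abs_le_iff field_simps)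
  \<comment> \<open>This absorbs \<open>8 * M\<close>. The constants then add up as
    \<open>312 = 112 + 8 + 192\<close> and \<open>56 = 24 + 32\<close>.\<close>
  have "1 \<le> divisor_sigma 0 n"
  proof -
    have "real 1 powr 0 \<le> (\<Sum>d | d dvd n. real d powr 0)"
      using n by (intro member_le_sum) auto
    then show ?thesis by (simp add: divisor_sigma_def)
  qed
  then have "1 * real M \<le> divisor_sigma 0 n * real M" by (intro mult_right_mono) auto
  moreover have "divisor_sigma 0 n * real M * 1 \<le> divisor_sigma 0 n * real M * L"
    using L sigma by (intro mult_left_mono mult_nonneg_nonneg) auto
  ultimately have "\<bar>real (card (det_quadruples n M)) - 96 * divisor_sigma (-1) n / pi\<^sup>2 * real M ^ 2\<bar>
      \<le> 312 * (divisor_sigma 0 n * real M * L) + 56 * (real n * L ^ 2)"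
    using 1 2 3 4 5 unfolding abs_le_iff by linarith
  then show ?thesis by (simp add: L_def mult.assoc)
qed

text \<open>Replacing the floor \<open>M\<close> by \<open>X\<close> in the main term costs at most
  \<open>96 * divisor_sigma 0 n * (2 * X)\<close>, so 312 grows by 192 to 504.\<close>

lemma num_det_matrices_asymp:
  assumes n: "n \<ge> 1" and X: "X \<ge> 1"
  shows "\<bar>real (num_det_matrices n X) - 96 * divisor_sigma (-1) n / pi\<^sup>2 * X\<^sup>2\<bar>
    \<le> 504 * divisor_sigma 0 n * X * (1 + ln X) + 56 * real n * (1 + ln X) ^ 2"
proof -
  define M where "M = nat \<lfloor>X\<rfloor>"
  define s where "s = 96 * divisor_sigma (-1) n / pi\<^sup>2"
  have M: "M \<ge> 1" using X by (simp add: M_def le_nat_iff)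
  have MX: "real M \<le> X" "X \<le> real M + 1" using X by (simp_all add: M_def)
  have lnX: "ln X \<ge> 0" using X by simp
  have ln: "0 \<le> ln (real M)" "ln (real M) \<le> ln X" using M MX by simp_all
  have sigma: "divisor_sigma 0 n \<ge> 0" using divisor_sigma_bounds[OF n] by linarith
  have "4 \<le> pi\<^sup>2" using pi_ge_two mult_mono[of 2 pi 2 pi] by (simp add: power2_eq_square)
  then have "1 * (96 * divisor_sigma (-1) n) \<le> pi\<^sup>2 * (96 * divisor_sigma 0 n)"
    using divisor_sigma_bounds(1,2)[OF n] by (intro mult_mono) simp_all
  then have s: "0 \<le> s" "s \<le> 96 * divisor_sigma 0 n"
    using divisor_sigma_bounds(1)[OF n] by (simp_all add: s_def divide_le_eq mult.commute)
  have "(X - M) * (X + M) \<le> 1 * (2 * X)" using MX by (intro mult_mono) auto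
  then have "X\<^sup>2 - real M ^ 2 \<le> 2 * X" by (simp add: algebra_simps power2_eq_square)
  moreover have "real M ^ 2 \<le> X\<^sup>2" using MX by (intro power_mono) auto
  ultimately have "s * (X\<^sup>2 - real M ^ 2) \<le> 96 * divisor_sigma 0 n * (2 * X)" "0 \<le> s * (X\<^sup>2 - real M ^ 2)"
    using s sigma by (intro mult_mono mult_nonneg_nonneg; simp)+
  then have 1: "\<bar>s * X\<^sup>2 - s * real M ^ 2\<bar> \<le> 192 * (divisor_sigma 0 n * X)"
    by (simp add: algebra_simps)
  have 2: "divisor_sigma 0 n * X * 1 \<le> divisor_sigma 0 n * X * (1 + ln X)"
    using X lnX sigma by (intro mult_left_mono) auto
  have 3: "divisor_sigma 0 n * real M * (1 + ln M) \<le> divisor_sigma 0 n * X * (1 + ln X)"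
    using MX X ln sigma by (intro mult_mono mult_left_mono mult_nonneg_nonneg) auto
  have 4: "real n * (1 + ln M) ^ 2 \<le> real n * (1 + ln X) ^ 2"
    using ln by (intro mult_left_mono power_mono) auto
  have "\<bar>real (num_det_matrices n X) - s * real M ^ 2\<bar>
      \<le> 312 * (divisor_sigma 0 n * real M * (1 + ln M)) + 56 * (real n * (1 + ln M) ^ 2)"
    using card_det_quadruples_asymp[OF n M] num_det_matrices_eq_card_det_quadruples[OF X, of n]
    by (simp add: s_def M_def mult.assoc)
  with 1 2 3 4 have "\<bar>real (num_det_matrices n X) - s * X\<^sup>2\<bar>
      \<le> 504 * (divisor_sigma 0 n * X * (1 + ln X)) + 56 * (real n * (1 + ln X) ^ 2)"
    unfolding abs_le_iff by linarith
  then show ?thesis by (simp add: s_def mult.assoc)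
qed

theorem theorem1:
  fixes \<epsilon> :: real
  assumes "\<epsilon> > 0"
  shows "\<exists>C::real. \<forall>(n::nat) (X::real). n \<ge> 1 \<longrightarrow> X \<ge> 1 \<longrightarrow>
           \<bar>real (num_det_matrices n X) - 96 * divisor_sigma (-1) n / pi\<^sup>2 * X\<^sup>2\<bar>
             \<le> C * (divisor_sigma 0 n * X * ln X + real n * X powr \<epsilon>)"
proof -
  \<comment> \<open>\<open>B\<close> comes from squaring
    \<open>1 + ln X <= (1 + 2 / \<epsilon>) * X powr (\<epsilon> / 2)\<close>, which absorbs the
    squared logarithm into \<open>X powr \<epsilon>\<close>.\<close>
  define B where "B = (1 + 2 / \<epsilon>) ^ 2"
  show ?thesis
  proof (intro exI[of _ "2016 + 56 * B"] allI impI)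
    fix n :: nat and X :: real
    assume n: "n \<ge> 1" and X: "X \<ge> 1"
    define P where "P = real n * X powr \<epsilon>"
    define Q where "Q = divisor_sigma 0 n * X * ln X"
    have lnX: "ln X \<ge> 0" using X by simp
    have sigma: "divisor_sigma 0 n \<ge> 0" "divisor_sigma 0 n \<le> real n"
      using divisor_sigma_bounds[OF n] by linarith+
    have Q0: "Q \<ge> 0" using X lnX sigma by (simp add: Q_def)
    have B0: "B \<ge> 0" by (simp add: B_def)
    have nP: "real n \<le> P" using ge_one_powr_ge_zero[of X \<epsilon>] X assms
      by (simp add: P_def mult_le_cancel_left1)
    have "ln X \<le> X powr (\<epsilon> / 2) / (\<epsilon> / 2)" using X assms by (intro ln_powr_bound) auto
    moreover have "1 \<le> X powr (\<epsilon> / 2)" using X assms by (intro ge_one_powr_ge_zero) auto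
    ultimately have "1 + ln X \<le> (1 + 2 / \<epsilon>) * X powr (\<epsilon> / 2)" by (simp add: algebra_simps)
    then have "(1 + ln X) ^ 2 \<le> ((1 + 2 / \<epsilon>) * X powr (\<epsilon> / 2)) ^ 2"
      using lnX by (intro power_mono) auto
    also have "\<dots> = B * X powr \<epsilon>"
      by (simp add: B_def power_mult_distrib power2_eq_square powr_add[symmetric])
    finally have "real n * (1 + ln X) ^ 2 \<le> real n * (B * X powr \<epsilon>)" by (rule mult_left_mono) simp
    then have 1: "real n * (1 + ln X) ^ 2 \<le> B * P" by (simp add: P_def mult_ac)
    \<comment> \<open>\<open>Q\<close> vanishes at \<open>X = 1\<close>, so it cannot dominate
      \<open>1 + ln X\<close> alone. For \<open>X >= 2\<close> it does, since
      \<open>ln X >= 1 / 2\<close>; for \<open>X < 2\<close> the left side is at most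
      \<open>4 * n <= 4 * P\<close>. The factor 4 yields \<open>2016 = 4 * 504\<close>.\<close>
    have 2: "divisor_sigma 0 n * X * (1 + ln X) \<le> 4 * (Q + P)"
    proof (cases "X \<ge> 2")
      case True
      have "1 / 2 \<le> ln (2 :: real)" using ln2_ge_two_thirds by simp
      also have "\<dots> \<le> ln X" using True by simp
      finally have "divisor_sigma 0 n * X * (1 + ln X) \<le> divisor_sigma 0 n * X * (4 * ln X)"
        using X sigma by (intro mult_left_mono) auto
      also have "\<dots> = 4 * Q" by (simp add: Q_def)
      finally show ?thesis using nP by simp
    next
      case False
      have "ln X \<le> X - 1" using X by (intro ln_le_minus_one) auto
      then have "divisor_sigma 0 n * (X * (1 + ln X)) \<le> real n * (2 * 2)"
        using False X sigma lnX by (intro mult_mono) auto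
      then show ?thesis using nP Q0 by (simp add: mult.assoc)
    qed
    have "\<bar>real (num_det_matrices n X) - 96 * divisor_sigma (-1) n / pi\<^sup>2 * X\<^sup>2\<bar>
        \<le> 504 * (divisor_sigma 0 n * X * (1 + ln X)) + 56 * (real n * (1 + ln X) ^ 2)"
      using num_det_matrices_asymp[OF n X] by (simp only: mult.assoc)
    also have "\<dots> \<le> 2016 * (Q + P) + 56 * (B * P)" using 1 2 by linarith
    also have "\<dots> \<le> (2016 + 56 * B) * (Q + P)" using Q0 B0 by (simp add: algebra_simps)
    finally show "\<bar>real (num_det_matrices n X) - 96 * divisor_sigma (-1) n / pi\<^sup>2 * X\<^sup>2\<bar>
        \<le> (2016 + 56 * B) * (divisor_sigma 0 n * X * ln X + real n * X powr \<epsilon>)"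
      by (simp only: P_def Q_def)
  qed
qed

end
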